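(* Let $\boldsymbol v\in\mathbb{G}_m^3$ and let $D\in\operatorname{Diag}_3^*$ be such that $h^*(D)>0$. Then, for all $\delta\in(0,1/9)$ and all $\boldsymbol x\in\mathbb{G}_m^3$, the inequality $$d^*\big(D^n\boldsymbol x,\boldsymbol v^\perp\big)\le n\,\delta\,h^*(D)$$ is satisfied for only finitely many $n\in\mathbb{N}_0$.
   Context: $\mathbb{G}_m^3$ denotes the group $(\overline{\mathbb{Q}}^* )^3$ with coordinatewise multiplication, and $h:\overline{\mathbb{Q}}^*\to\mathbb{R}_{\ge0}$ is the absolute logarithmic Weil height. For $\boldsymbol x,\boldsymbol y\in\mathbb{G}_m^3$, $h^*(\boldsymbol x):=\max_{1\le i<j\le3}h(x_i/x_j)$ and $d^*(\boldsymbol x,\boldsymbol y):=h^*(\boldsymbol x\boldsymbol y^{-1})$. For a non-empty subset $S\subseteq\mathbb{G}_m^3$, $d^*(\boldsymbol x,S):=\inf_{\boldsymbol y\in S}d^*(\boldsymbol x,\boldsymbol y)$. $\operatorname{Diag}_3^*$ is the set of $3\times3$ diagonal matrices whose diagonal entries are non-zero algebraic numbers; for $D=\operatorname{diag}(\lambda_1,\lambda_2,\lambda_3)\in\operatorname{Diag}_3^*$, $h^*(D):=h^*(\lambda_1,\lambda_2,\lambda_3)$. For $\boldsymbol v\in\mathbb{G}_m^3$, $\boldsymbol v^\perp:=\{\boldsymbol x\in\mathbb{G}_m^3:v_1x_1+v_2x_2+v_3x_3=0\}$. *)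

theory Defs
  imports "HOL-Analysis.Analysis" "Berlekamp_Zassenhaus.Mahler_Measure" "Subresultants.Subresultant_Gcd"
begin

no_notation vec_index (infixl \<open>$\<close> 100)

text \<open>
  The field of algebraic numbers is taken inside the complex numbers, through the library
  predicate \<^const>\<open>algebraic\<close>. Integer irreducibility includes primitivity, so together with the
  sign of the leading coefficient it determines the minimal polynomial over the integers.
\<close>

definition int_min_poly :: "complex \<Rightarrow> int poly" where
  "int_min_poly a =
    (THE p. irreducible p \<and> lead_coeff p > 0 \<and> poly (map_poly of_int p) a = 0)"

lemma int_min_poly_ex1:
  assumes "algebraic a"
  shows "\<exists>!p. irreducible p \<and> lead_coeff p > 0 \<and> poly (map_poly of_int p :: complex poly) a = 0"
proof -
  obtain q where q: "q \<noteq> 0" "poly (map_poly of_int q :: complex poly) a = 0"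
    using assms by (rule algebraicE')
  have ex: "\<exists>p. irreducible p \<and> poly (map_poly of_int p :: complex poly) a = 0"
    using q
  proof (induction q rule: prime_divisors_induct)
    case (unit x)
    then obtain c where c: "x = [:c:]" "c dvd 1"
      by (auto simp: is_unit_poly_iff)
    with unit show ?case by auto
  next
    case (factor p x)
    then show ?case by (auto simp: of_int_poly_hom.hom_mult dest: prime_elem_imp_irreducible)
  qed auto
  then obtain p0 where p0: "irreducible p0" "poly (map_poly of_int p0 :: complex poly) a = 0"
    by blast
  define p where "p = (if lead_coeff p0 > 0 then p0 else - p0)"
  have nz: "p0 \<noteq> 0" using p0 by auto
  then have "lead_coeff p0 > 0 \<or> lead_coeff p0 < 0"
    by (metis leading_coeff_0_iff linorder_neqE_linordered_idom)
  then have pp: "p = p0 \<and> lead_coeff p0 > 0 \<or> p = - p0 \<and> lead_coeff p0 < 0"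
    by (auto simp: p_def)
  then have P: "irreducible p \<and> lead_coeff p > 0 \<and> poly (map_poly of_int p :: complex poly) a = 0"
    using p0 by (auto simp: irreducible_uminus of_int_poly_hom.hom_uminus)
  moreover have "p = r"
    if R: "irreducible r \<and> lead_coeff r > 0 \<and> poly (map_poly of_int r :: complex poly) a = 0" for r
  proof -
    let ?P = "map_poly of_int p :: complex poly" and ?R = "map_poly of_int r :: complex poly"
    have "[:-a, 1:] dvd gcd ?P ?R"
      using P R by (simp add: poly_eq_0_iff_dvd)
    moreover have "gcd ?P ?R \<noteq> 0" using P by auto
    ultimately have "degree (gcd ?P ?R) \<noteq> 0"
      by (metis degree_pCons_eq_if dvd_imp_degree_le le_zero_eq one_neq_zero one_pCons
          pCons_eq_0_iff zero_neq_one nat.distinct(1))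
    then have "resultant ?P ?R = 0" by (simp add: resultant_0_gcd)
    then have "resultant p r = 0"
      by (simp add: of_int_hom.resultant_map_poly)
    then have "degree (gcd p r) \<noteq> 0" by (simp add: resultant_0_gcd)
    then have nu: "\<not> is_unit (gcd p r)" by (auto simp: is_unit_poly_iff)
    have "p dvd gcd p r" "r dvd gcd p r"
      using P R nu by (meson gcd_dvd1 gcd_dvd2 irreducibleD')+
    then have "p dvd r" "r dvd p" by auto
    then have eq: "normalize p = normalize r" by (simp add: associated_iff_dvd)
    show "p = r"
      using eq P R by (auto simp: normalize_poly_def unit_factor_int_def is_unit_poly_iff)
  qed
  ultimately show ?thesis by blast
qed

text \<open>
  Absolute logarithmic Weil height of an algebraic number: the logarithm of the Mahler measure of
  its minimal polynomial over the integers, divided by its degree.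
\<close>

definition weil_height :: "complex \<Rightarrow> real" where
  "weil_height a = ln (mahler_measure (int_min_poly a)) / real (degree (int_min_poly a))"

definition Gm3 :: "(complex ^ 3) set" where
  "Gm3 = {x. \<forall>i. algebraic (x $ i) \<and> x $ i \<noteq> 0}"

definition hstar :: "complex ^ 3 \<Rightarrow> real" where
  "hstar x = Max {weil_height (x $ 1 / x $ 2), weil_height (x $ 1 / x $ 3),
                  weil_height (x $ 2 / x $ 3)}"

definition dstar :: "complex ^ 3 \<Rightarrow> complex ^ 3 \<Rightarrow> real" where
  "dstar x y = hstar (x * (\<chi> i. inverse (y $ i)))"

definition dstar_set :: "complex ^ 3 \<Rightarrow> (complex ^ 3) set \<Rightarrow> real" where
  "dstar_set x S = (INF y\<in>S. dstar x y)"

definition Diag3 :: "(complex ^ 3 ^ 3) set" where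
  "Diag3 = {D. (\<forall>i j. i \<noteq> j \<longrightarrow> D $ i $ j = 0) \<and> (\<forall>i. algebraic (D $ i $ i) \<and> D $ i $ i \<noteq> 0)}"

definition hstar_mat :: "complex ^ 3 ^ 3 \<Rightarrow> real" where
  "hstar_mat D = hstar (\<chi> i. D $ i $ i)"

text \<open>
  Matrix power. The product \<open>(*)\<close> on vectors is componentwise, hence \<open>(^)\<close> on matrices would be
  the entrywise power.
\<close>

definition mat_power :: "complex ^ 3 ^ 3 \<Rightarrow> nat \<Rightarrow> complex ^ 3 ^ 3" where
  "mat_power D n = (((**) D) ^^ n) (Finite_Cartesian_Product.mat 1)"

definition perp :: "complex ^ 3 \<Rightarrow> (complex ^ 3) set" where
  "perp v = {x \<in> Gm3. v $ 1 * x $ 1 + v $ 2 * x $ 2 + v $ 3 * x $ 3 = 0}"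

end

theory Submission
  imports Defs "Jordan_Normal_Form.Char_Poly"
begin

text \<open>
  If \<open>d\<^sup>*(D\<^sup>n x, v\<^sup>\<bottom>)\<close> is small, then \<open>X + Y = 1\<close> for numbers \<open>X = a \<lambda>\<^sup>n / u\<close> and \<open>Y = b \<mu>\<^sup>n / t\<close>,
  where \<open>u\<close>, \<open>t\<close> and \<open>u / t\<close> have height at most \<open>n \<delta> H\<close> and \<open>H = h\<^sup>*(D)\<close>. Hence
  \<open>h(X) \<ge> n (1 - \<delta>) H - O(1)\<close>. Fix one such \<open>n\<close>, let \<open>m\<close> be a much larger solution
  and write \<open>m = (2 k + 1) n + r\<close> with \<open>r \<le> 2 n\<close>. Then \<open>A X\<^sup>2\<^sup>k\<^sup>+\<^sup>1 + B Y\<^sup>2\<^sup>k\<^sup>+\<^sup>1 = 1\<close>, and the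
  heights of \<open>A\<close> and \<open>B\<close> are at most \<open>4 k n \<delta> H + O(k) + O(n)\<close>, where \<open>O(k)\<close> is uniform
  in \<open>n\<close>. The explicit polynomials \<open>P\<close>, \<open>Q\<close>, \<open>R\<close> of degree at most \<open>k\<close> with
  \<open>x\<^sup>2\<^sup>k\<^sup>+\<^sup>1 P + (1 - x)\<^sup>2\<^sup>k\<^sup>+\<^sup>1 Q = R\<close> give a second linear relation, so that \<open>X\<^sup>2\<^sup>k\<^sup>+\<^sup>1\<close> is a
  quotient of expressions that are linear in \<open>A\<close> and \<open>B\<close> and of degree at most \<open>k + 1\<close> in \<open>X\<close>. This
  yields \<open>k h(X) \<le> h(A) + h(B) + O(k)\<close>, and \<open>k \<rightarrow> \<infinity>\<close> gives \<open>h(X) \<le> 8 n \<delta> H + O(1)\<close>,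
  which bounds \<open>n\<close> because \<open>9 \<delta> < 1\<close>.

  The height inequalities do not need valuations: in a number field with embeddings \<open>\<sigma>\<close>, the
  denominators are controlled by the fact that the leading coefficient of an integer polynomial
  times the product of any subset of its roots is an algebraic integer.
\<close>

hide_const (open) up_ring.coeff up_ring.monom Module.smult

section \<open>Algebraic integers\<close>

text \<open>The complex numbers form a module over the integers, so that \<open>int_span\<close>
  yields the finitely generated additive groups by which algebraic integers are recognised.\<close>

definition int_scale :: "int \<Rightarrow> complex \<Rightarrow> complex" where
  "int_scale n z = of_int n * z"

global_interpretation int_module: Modules.module int_scale
  defines int_span = int_module.span
  by unfold_locales (auto simp: int_scale_def algebra_simps)

text \<open>The determinant trick: multiplication by \<open>a\<close> on the generators is described
  by an integer matrix \<open>M\<close>, and the vector of generators is an eigenvector for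
  \<open>a\<close>. So \<open>a\<close> is a root of the monic characteristic polynomial of
  \<open>M\<close>.\<close>

lemma stable_span_imp_algebraic_int:
  assumes "finite B" "b0 \<in> B" "b0 \<noteq> 0" and stable: "\<And>b. b \<in> B \<Longrightarrow> a * b \<in> int_span B"
  shows "algebraic_int a"
proof -
  obtain bs where bs: "set bs = B" "distinct bs"
    using finite_distinct_list[OF assms(1)] by blast
  define n where "n = length bs"
  have "\<exists>u. a * b = (\<Sum>v\<in>B. of_int (u v) * v)" if "b \<in> B" for b
    using stable[OF that] unfolding int_module.span_finite[OF assms(1)] by (auto simp: int_scale_def)
  then obtain u where u: "\<And>b. b \<in> B \<Longrightarrow> a * b = (\<Sum>v\<in>B. of_int (u b v) * v)"
    by metis
  define M :: "int mat" where "M = Matrix.mat n n (\<lambda>(i, j). u (bs ! i) (bs ! j))"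
  define w where "w = Matrix.vec n (\<lambda>i. bs ! i)"
  have M: "M \<in> carrier_mat n n" and w: "w \<in> carrier_vec n"
    by (auto simp: M_def w_def)
  have bij: "bij_betw (\<lambda>i. bs ! i) {0..<n} B"
    using bij_betw_nth[of bs "{0..<n}" B] bs by (simp add: n_def atLeast0LessThan)
  have "map_mat of_int M *\<^sub>v w = a \<cdot>\<^sub>v w"
  proof (rule eq_vecI)
    fix i assume "i < dim_vec (a \<cdot>\<^sub>v w)"
    then have i: "i < n" by (simp add: w_def)
    then have "vec_index (map_mat of_int M *\<^sub>v w) i
        = (\<Sum>j\<in>{0..<n}. of_int (u (bs ! i) (bs ! j)) * bs ! j)"
      by (simp add: M_def w_def scalar_prod_def)
    also have "\<dots> = (\<Sum>v\<in>B. of_int (u (bs ! i) v) * v)"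
      by (rule sum.reindex_bij_betw[OF bij])
    also have "\<dots> = a * bs ! i"
      using u[of "bs ! i"] i bs by (auto simp: n_def)
    finally show "vec_index (map_mat of_int M *\<^sub>v w) i = vec_index (a \<cdot>\<^sub>v w) i"
      using i by (simp add: w_def)
  qed (auto simp: M_def w_def)
  moreover have "w \<noteq> 0\<^sub>v n"
  proof
    assume eq: "w = 0\<^sub>v n"
    from assms(2) bs obtain i where "i < n" "bs ! i = b0"
      by (auto simp: n_def in_set_conv_nth)
    then have "vec_index w i = b0" by (simp add: w_def)
    with eq \<open>i < n\<close> assms(3) show False by simp
  qed
  ultimately have "eigenvalue (map_mat of_int M) a"
    using M w by (auto simp: eigenvalue_def eigenvector_def intro!: exI[of _ w])
  then have "poly (char_poly (map_mat of_int M)) a = 0"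
    using eigenvalue_root_char_poly[of "map_mat of_int M" n a] M by simp
  moreover have "char_poly (map_mat of_int M :: complex mat) = map_poly of_int (char_poly M)"
    by (rule of_int_hom.char_poly_hom[OF M])
  ultimately have "poly (map_poly of_int (char_poly M)) a = 0" by simp
  moreover have "lead_coeff (char_poly M) = 1"
    using degree_monic_char_poly[OF M] by simp
  ultimately show ?thesis
    unfolding algebraic_int_altdef_ipoly by blast
qed

lemma span_mult_right:
  assumes "x \<in> int_span B" "d \<in> D"
  shows "x * d \<in> int_span ((\<lambda>(b, d). b * d) ` (B \<times> D))"
  using assms(1)
proof (induction rule: int_module.span_induct_alt)
  case base
  show ?case by (simp add: int_module.span_zero)
next
  case (step c x y)
  have "x * d \<in> int_span ((\<lambda>(b, d). b * d) ` (B \<times> D))"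
    using step assms(2) by (intro int_module.span_base) auto
  from int_module.span_add[OF int_module.span_scale[OF this, of c] step.IH]
  show ?case by (simp add: int_scale_def algebra_simps)
qed

text \<open>Adjoins a root of a monic polynomial: the products \<open>b * a ^ j\<close> with
  \<open>j < degree p\<close> generate a group stable under \<open>a\<close>, because the monic
  equation rewrites \<open>a ^ degree p\<close> in lower powers. Whatever preserved the old group
  preserves the new one, which allows iteration.\<close>

lemma stable_extend_root:
  fixes p :: "complex poly"
  assumes "finite B" "1 \<in> B" "lead_coeff p = 1" "poly p a = 0"
    and coeffs: "\<And>i b. b \<in> B \<Longrightarrow> coeff p i * b \<in> int_span B"
  obtains B' where "finite B'" "1 \<in> B'" "\<And>b. b \<in> B' \<Longrightarrow> a * b \<in> int_span B'"
    "\<And>c b. (\<And>b. b \<in> B \<Longrightarrow> c * b \<in> int_span B) \<Longrightarrow> b \<in> B' \<Longrightarrow> c * b \<in> int_span B'"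
proof -
  define n where "n = degree p"
  have "n > 0"
  proof (rule ccontr)
    assume "\<not> n > 0"
    then obtain c where "p = [:c:]" using degree_eq_zeroE[of p] by (auto simp: n_def)
    with assms show False by simp
  qed
  define D where "D = (\<lambda>j. a ^ j) ` {..<n}"
  define B' where "B' = (\<lambda>(b, d). b * d) ` (B \<times> D)"
  have mem: "x * a ^ j \<in> int_span B'" if "x \<in> int_span B" "j < n" for x j
    unfolding B'_def by (rule span_mult_right) (use that in \<open>auto simp: D_def\<close>)
  show ?thesis
  proof (rule that)
    show "finite B'" using assms by (simp add: B'_def D_def)
    have "1 \<in> D" using \<open>n > 0\<close> by (auto simp: D_def intro!: image_eqI[of _ _ 0])
    then show "1 \<in> B'" using assms by (force simp: B'_def)
  next
    fix b assume "b \<in> B'"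
    then obtain b0 j where b: "b0 \<in> B" "j < n" "b = b0 * a ^ j" by (auto simp: B'_def D_def)
    show "a * b \<in> int_span B'"
    proof (cases "Suc j < n")
      case True
      then show ?thesis using mem[of b0 "Suc j"] b
        by (simp add: int_module.span_base mult_ac)
    next
      case False
      then have j: "Suc j = n" using b by simp
      have "0 = (\<Sum>i\<le>n. coeff p i * a ^ i)"
        using assms by (simp add: poly_altdef n_def)
      also have "\<dots> = a ^ n + (\<Sum>i<n. coeff p i * a ^ i)"
        using assms by (simp add: lessThan_Suc_atMost[symmetric] n_def)
      finally have an: "a ^ n = - (\<Sum>i<n. coeff p i * a ^ i)"
        by (simp add: eq_neg_iff_add_eq_0)
      have "a * b = b0 * a ^ n" using b j by (auto simp: mult_ac)
      also have "\<dots> = - (\<Sum>i<n. (coeff p i * b0) * a ^ i)"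
        by (simp add: an sum_distrib_left mult_ac)
      also have "\<dots> \<in> int_span B'"
        using b coeffs by (intro int_module.span_neg int_module.span_sum mem) auto
      finally show ?thesis .
    qed
  next
    fix c b
    assume c: "\<And>b. b \<in> B \<Longrightarrow> c * b \<in> int_span B" and "b \<in> B'"
    then obtain b0 j where b: "b0 \<in> B" "j < n" "b = b0 * a ^ j" by (auto simp: B'_def D_def)
    then show "c * b \<in> int_span B'"
      using mem[OF c[OF b(1)], of j] by (simp add: mult_ac)
  qed
qed

text \<open>Induction on \<open>C\<close>, adjoining one algebraic integer at a time; the
  coefficients of its monic polynomial are integers, which preserve every additive group.\<close>

lemma common_stable_set:
  assumes "finite C" "\<And>c. c \<in> C \<Longrightarrow> algebraic_int c"
  obtains B where "finite B" "1 \<in> B" "\<And>c b. c \<in> C \<Longrightarrow> b \<in> B \<Longrightarrow> c * b \<in> int_span B"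
proof -
  have "\<exists>B. finite B \<and> 1 \<in> B \<and> (\<forall>c\<in>C. \<forall>b\<in>B. c * b \<in> int_span B)"
    using assms
  proof (induction C rule: finite_induct)
    case empty
    show ?case by (intro exI[of _ "{1}"]) auto
  next
    case (insert c C)
    then obtain B where B: "finite B" "1 \<in> B" "\<forall>c\<in>C. \<forall>b\<in>B. c * b \<in> int_span B"
      by auto
    from insert.prems[of c] obtain p where p: "lead_coeff p = 1" "\<forall>i. coeff p i \<in> \<int>" "poly p c = 0"
      by (auto elim: algebraic_int.cases)
    have "coeff p i * b \<in> int_span B" if "b \<in> B" for i b
    proof -
      from p obtain k where "coeff p i = of_int k" by (auto elim: Ints_cases)
      then show ?thesis using int_module.span_scale[OF int_module.span_base[OF that], of k]
        by (simp add: int_scale_def)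
    qed
    from stable_extend_root[OF B(1,2) p(1) p(3) this] obtain B' where
      "finite B'" "1 \<in> B'" "\<And>b. b \<in> B' \<Longrightarrow> c * b \<in> int_span B'"
      "\<And>c b. (\<And>b. b \<in> B \<Longrightarrow> c * b \<in> int_span B) \<Longrightarrow> b \<in> B' \<Longrightarrow> c * b \<in> int_span B'"
      by blast
    with B show ?case by (intro exI[of _ B']) auto
  qed
  with that show ?thesis by blast
qed

text \<open>First a group stable under all coefficients is taken, then \<open>a\<close> is adjoined
  to it; the determinant trick applies to the result.\<close>

lemma algebraic_int_integral_closure:
  fixes p :: "complex poly"
  assumes "lead_coeff p = 1" "poly p a = 0" "\<And>i. algebraic_int (coeff p i)"
  shows "algebraic_int a"
proof -
  have "finite (range (coeff p))"
  proof (rule finite_subset)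
    show "range (coeff p) \<subseteq> insert 0 (coeff p ` {..degree p})"
      by (auto intro: le_degree)
  qed auto
  moreover have "\<And>c. c \<in> range (coeff p) \<Longrightarrow> algebraic_int c"
    using assms(3) by auto
  ultimately obtain B where
    B: "finite B" "1 \<in> B" "\<And>c b. c \<in> range (coeff p) \<Longrightarrow> b \<in> B \<Longrightarrow> c * b \<in> int_span B"
    by (rule common_stable_set) blast+
  have "\<And>i b. b \<in> B \<Longrightarrow> coeff p i * b \<in> int_span B" using B(3) by blast
  from stable_extend_root[OF B(1,2) assms(1,2) this] obtain B' where
    "finite B'" "1 \<in> B'" "\<And>b. b \<in> B' \<Longrightarrow> a * b \<in> int_span B'"
    by metis
  then show ?thesis by (intro stable_span_imp_algebraic_int[of B' 1]) auto
qed

lemma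
  fixes a b :: complex
  assumes "algebraic_int a" "algebraic_int b"
  shows algebraic_int_add: "algebraic_int (a + b)"
    and algebraic_int_mult: "algebraic_int (a * b)"
proof -
  have ints: "finite {a, b}" "\<And>c. c \<in> {a, b} \<Longrightarrow> algebraic_int c"
    using assms by auto
  obtain B where
    B: "finite B" "1 \<in> B" "\<And>c x. c \<in> {a, b} \<Longrightarrow> x \<in> B \<Longrightarrow> c * x \<in> int_span B"
    by (rule common_stable_set[OF ints]) blast+
  \<comment> \<open>Stability is given on generators only, while \<open>b * x\<close> is merely in
    the span; so it is extended to the span here.\<close>
  have ax: "a * x \<in> int_span B" if "x \<in> int_span B" for x
    using that
  proof (induction rule: int_module.span_induct_alt)
    case (step c x y)
    have "int_scale c (a * x) + a * y \<in> int_span B"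
      using step B(3) by (intro int_module.span_add int_module.span_scale) auto
    then show ?case by (simp add: int_scale_def algebra_simps)
  qed (simp add: int_module.span_zero)
  show "algebraic_int (a + b)"
  proof (rule stable_span_imp_algebraic_int[of B 1])
    fix x assume "x \<in> B"
    with B(3) have "a * x + b * x \<in> int_span B" by (intro int_module.span_add) auto
    then show "(a + b) * x \<in> int_span B" by (simp add: algebra_simps)
  qed (use B in auto)
  show "algebraic_int (a * b)"
  proof (rule stable_span_imp_algebraic_int[of B 1])
    fix x assume "x \<in> B"
    with B(3) ax[of "b * x"] show "a * b * x \<in> int_span B" by (simp add: mult_ac)
  qed (use B in auto)
qed

lemma algebraic_int_of_int [simp]: "algebraic_int (of_int k :: complex)"
  by (rule int_imp_algebraic_int) auto

lemma algebraic_int_one: "algebraic_int (1 :: complex)"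
  using algebraic_int_of_int[of 1] by simp

lemma algebraic_int_sum:
  fixes f :: "'a \<Rightarrow> complex"
  shows "(\<And>i. i \<in> I \<Longrightarrow> algebraic_int (f i)) \<Longrightarrow> algebraic_int (sum f I)"
  by (induction I rule: infinite_finite_induct) (auto intro: algebraic_int_add)

lemma algebraic_int_prod:
  fixes f :: "'a \<Rightarrow> complex"
  shows "(\<And>i. i \<in> I \<Longrightarrow> algebraic_int (f i)) \<Longrightarrow> algebraic_int (prod f I)"
  by (induction I rule: infinite_finite_induct) (auto intro: algebraic_int_mult algebraic_int_one)

lemma algebraic_int_power:
  "algebraic_int (a :: complex) \<Longrightarrow> algebraic_int (a ^ n)"
  by (induction n) (auto intro: algebraic_int_mult algebraic_int_one)

lemma algebraic_int_power_cancel: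
  fixes a :: complex
  assumes "algebraic_int (a ^ n)" "n > 0"
  shows "algebraic_int a"
  using assms(1)
  by (rule algebraic_int_root[where p = "monom 1 n"])
     (use assms(2) in \<open>auto simp: poly_monom degree_monom_eq\<close>)

section \<open>Polynomials with algebraic integer coefficients\<close>

definition alg_int_poly :: "complex poly \<Rightarrow> bool" where
  "alg_int_poly p \<longleftrightarrow> (\<forall>i. algebraic_int (coeff p i))"

lemma alg_int_poly_mult:
  "alg_int_poly p \<Longrightarrow> alg_int_poly q \<Longrightarrow> alg_int_poly (p * q)"
  unfolding alg_int_poly_def coeff_mult
  by (auto intro!: algebraic_int_sum algebraic_int_mult)

lemma alg_int_poly_one: "alg_int_poly 1"
  by (auto simp: alg_int_poly_def algebraic_int_one)

lemma alg_int_poly_prod: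
  "(\<And>i. i \<in> I \<Longrightarrow> alg_int_poly (f i)) \<Longrightarrow> alg_int_poly (prod f I)"
  by (induction I rule: infinite_finite_induct)
     (auto intro: alg_int_poly_mult alg_int_poly_one)

lemma alg_int_poly_sum:
  "(\<And>i. i \<in> I \<Longrightarrow> alg_int_poly (f i)) \<Longrightarrow> alg_int_poly (sum f I)"
  by (auto simp: alg_int_poly_def coeff_sum intro!: algebraic_int_sum)

lemma alg_int_poly_diff:
  "alg_int_poly p \<Longrightarrow> alg_int_poly q \<Longrightarrow> alg_int_poly (p - q)"
  using algebraic_int_add[of "coeff p i" "- coeff q i" for i]
  by (simp add: alg_int_poly_def)

lemma alg_int_poly_smult:
  "algebraic_int c \<Longrightarrow> alg_int_poly p \<Longrightarrow> alg_int_poly (smult c p)"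
  by (auto simp: alg_int_poly_def intro: algebraic_int_mult)

lemma alg_int_poly_map_of_int: "alg_int_poly (map_poly of_int p)"
  by (simp add: alg_int_poly_def coeff_map_poly)

text \<open>With the monic polynomial \<open>c\<^sup>n\<^sup>-\<^sup>1 p(X/c)\<close>, where \<open>c\<close> is the leading coefficient.\<close>

lemma algebraic_int_lead_coeff_mult_root:
  fixes p :: "complex poly"
  assumes "alg_int_poly p" "poly p a = 0" "p \<noteq> 0"
  shows "algebraic_int (lead_coeff p * a)"
proof -
  define n where "n = degree p"
  define c where "c = lead_coeff p"
  have "c \<noteq> 0" using assms by (simp add: c_def)
  have "n > 0"
  proof (rule ccontr)
    assume "\<not> n > 0"
    then obtain c where "p = [:c:]" using degree_eq_zeroE[of p] by (auto simp: n_def)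
    with assms show False by simp
  qed
  define q where "q = monom 1 n + (\<Sum>i<n. monom (coeff p i * c ^ (n - 1 - i)) i)"
  have cq: "coeff q i = (if i = n then 1 else if i < n then coeff p i * c ^ (n - 1 - i) else 0)" for i
    by (simp add: q_def coeff_sum coeff_monom sum.delta)
  have "degree q = n"
    by (rule antisym[OF degree_le le_degree]) (auto simp: cq)
  then have lc: "lead_coeff q = 1" by (simp add: cq)
  have "poly q (c * a) = (c * a) ^ n + (\<Sum>i<n. coeff p i * c ^ (n - 1 - i) * (c * a) ^ i)"
    by (simp add: q_def poly_sum poly_monom)
  also have "(\<Sum>i<n. coeff p i * c ^ (n - 1 - i) * (c * a) ^ i)
      = (\<Sum>i<n. c ^ (n - 1) * (coeff p i * a ^ i))"
  proof (rule sum.cong, goal_cases)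
    case (2 i)
    then have "c ^ (n - 1) = c ^ (n - 1 - i) * c ^ i" by (simp flip: power_add)
    then show ?case by (simp add: power_mult_distrib)
  qed auto
  also have "(c * a) ^ n = c ^ (n - 1) * (coeff p n * a ^ n)"
    using \<open>n > 0\<close> by (cases n) (auto simp: power_mult_distrib c_def n_def)
  also have "\<dots> + (\<Sum>i<n. c ^ (n - 1) * (coeff p i * a ^ i)) = c ^ (n - 1) * (\<Sum>i\<le>n. coeff p i * a ^ i)"
    by (simp add: lessThan_Suc_atMost[symmetric] sum_distrib_left algebra_simps)
  also have "\<dots> = 0" using assms by (simp add: poly_altdef n_def)
  finally have "poly q (c * a) = 0" .
  moreover have "algebraic_int (coeff q i)" for i
    using assms(1) by (auto simp: cq c_def alg_int_poly_def algebraic_int_one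
        intro!: algebraic_int_mult algebraic_int_power)
  ultimately show ?thesis
    using algebraic_int_integral_closure[OF lc, of "c * a"] by (simp add: c_def)
qed

lemma alg_int_poly_remove_linear_factor:
  assumes "alg_int_poly ([:- a, 1:] * p)"
  shows "alg_int_poly p"
proof (cases "p = 0")
  case True
  then show ?thesis by (simp add: alg_int_poly_def)
next
  case False
  \<comment> \<open>Synthetic division from the top: subtract \<open>c X\<^sup>n (X - a)\<close>, whose coefficients are integral.\<close>
  then show ?thesis using assms
  proof (induction "degree p" arbitrary: p rule: less_induct)
    case less
    define n where "n = degree p"
    define c where "c = lead_coeff p"
    let ?q = "[:- a, 1:] * p"
    have nz: "?q \<noteq> 0" using less.prems(1) by (simp only: mult_eq_0_iff) auto
    have lcq: "lead_coeff ?q = c"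
      by (simp only: lead_coeff_mult c_def) simp
    have c: "algebraic_int c"
      using less.prems(2) lcq by (metis alg_int_poly_def)
    have ca: "algebraic_int (c * a)"
      using algebraic_int_lead_coeff_mult_root[OF less.prems(2) _ nz, of a] lcq by simp
    define r where "r = p - monom c n"
    have "alg_int_poly (smult c (monom 1 (Suc n)) + smult (- (c * a)) (monom 1 n))"
      using c ca by (auto simp: alg_int_poly_def coeff_monom intro!: algebraic_int_add algebraic_int_minus algebraic_int_one)
    then have al: "alg_int_poly ([:- a, 1:] * monom c n)"
      by (simp add: smult_monom monom_Suc algebra_simps)
    have "[:- a, 1:] * r = ?q - [:- a, 1:] * monom c n"
      by (simp only: r_def right_diff_distrib)
    moreover have "alg_int_poly (?q - [:- a, 1:] * monom c n)"
      using less.prems(2) al by (rule alg_int_poly_diff)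
    ultimately have al_r: "alg_int_poly ([:- a, 1:] * r)" by simp
    have "alg_int_poly r"
    proof (cases "r = 0")
      case False
      have "coeff r n = 0" by (simp add: r_def c_def n_def)
      moreover have "degree r \<le> n"
        by (auto simp: r_def n_def degree_diff_le degree_monom_le)
      ultimately have "degree r < n"
        using False by (metis le_neq_implies_less leading_coeff_0_iff)
      then show ?thesis using less.hyps[of r] False al_r by (simp add: n_def)
    qed (simp add: alg_int_poly_def)
    moreover have "p = r + smult c (monom 1 n)" by (simp add: r_def smult_monom)
    ultimately show "alg_int_poly p" using c
      by (auto simp: alg_int_poly_def coeff_monom intro: algebraic_int_add algebraic_int_one)
  qed
qed

text \<open>The linear factors of the roots outside \<open>S\<close> are divided out; up to sign,
  the constant term of what remains is \<open>c\<close> times the product over \<open>S\<close>.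
  Indexing the roots by \<open>f\<close> takes care of multiplicities.\<close>

lemma algebraic_int_lead_coeff_mult_prod_roots:
  assumes "finite Z" "alg_int_poly (smult c (\<Prod>z\<in>Z. [:- f z, 1:]))" "S \<subseteq> Z"
  shows "algebraic_int (c * (\<Prod>z\<in>S. f z))"
proof -
  have fin: "finite S" using assms finite_subset by blast
  have "alg_int_poly (smult c (\<Prod>z\<in>S. [:- f z, 1:]))"
    if "finite T" "alg_int_poly (smult c (\<Prod>z\<in>S \<union> T. [:- f z, 1:]))" "S \<inter> T = {}" for T
    using that
  proof (induction T rule: finite_induct)
    case (insert t T)
    have "(\<Prod>z\<in>S \<union> insert t T. [:- f z, 1:]) = [:- f t, 1:] * (\<Prod>z\<in>S \<union> T. [:- f z, 1:])"
      using insert fin by (subst Un_insert_right, subst prod.insert) auto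
    with insert.prems have "alg_int_poly ([:- f t, 1:] * smult c (\<Prod>z\<in>S \<union> T. [:- f z, 1:]))"
      by simp
    from alg_int_poly_remove_linear_factor[OF this] insert show ?case by auto
  qed auto
  from this[of "Z - S"] assms have al: "alg_int_poly (smult c (\<Prod>z\<in>S. [:- f z, 1:]))"
    by (auto simp: Un_absorb1)
  have "coeff (smult c (\<Prod>z\<in>S. [:- f z, 1:])) 0 = c * (\<Prod>z\<in>S. - f z)"
    by (simp flip: poly_0_coeff_0 add: poly_prod)
  also have "\<dots> = (-1) ^ card S * (c * (\<Prod>z\<in>S. f z))"
    by (subst prod_uminus) (simp add: mult_ac)
  finally have "algebraic_int ((-1) ^ card S * (c * (\<Prod>z\<in>S. f z)))"
    using al unfolding alg_int_poly_def by metis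
  then show ?thesis by (cases "even (card S)") auto
qed

section \<open>Conjugates and norms\<close>

lemma int_min_poly:
  assumes "algebraic a"
  shows irreducible_int_min_poly: "irreducible (int_min_poly a)"
    and lead_coeff_int_min_poly: "lead_coeff (int_min_poly a) > 0"
    and poly_int_min_poly: "poly (map_poly of_int (int_min_poly a) :: complex poly) a = 0"
  using theI'[OF int_min_poly_ex1[OF assms]] unfolding int_min_poly_def by auto

lemma int_poly_root_nonconst:
  fixes f :: "int poly"
  assumes "f \<noteq> 0" "poly (map_poly of_int f) (z :: complex) = 0"
  shows "degree f > 0"
proof (rule ccontr)
  assume "\<not> degree f > 0"
  then obtain c where "f = [:c:]" using degree_eq_zeroE[of f] by auto
  with assms show False by simp
qed

text \<open>A common complex root makes the resultant vanish. The resultant is the same over the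
  integers, so \<open>f\<close> and \<open>g\<close> have a nonconstant common factor there, and the
  irreducible \<open>f\<close> divides it.\<close>

lemma irreducible_int_poly_dvd:
  fixes f g :: "int poly" and z :: complex
  assumes f: "irreducible f" "poly (map_poly of_int f) z = 0" and g: "poly (map_poly of_int g) z = 0"
  shows "f dvd g"
proof -
  let ?F = "map_poly of_int f :: complex poly" and ?G = "map_poly of_int g :: complex poly"
  have "[:- z, 1:] dvd gcd ?F ?G"
    using f g by (simp add: poly_eq_0_iff_dvd)
  moreover have "gcd ?F ?G \<noteq> 0" using f by auto
  ultimately have "degree (gcd ?F ?G) \<noteq> 0"
    by (metis degree_pCons_eq_if dvd_imp_degree_le le_zero_eq one_neq_zero one_pCons
        pCons_eq_0_iff zero_neq_one nat.distinct(1))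
  then have "resultant ?F ?G = 0" by (simp add: resultant_0_gcd)
  then have "resultant f g = 0"
    by (simp add: of_int_hom.resultant_map_poly)
  then have "degree (gcd f g) \<noteq> 0" by (simp add: resultant_0_gcd)
  then have "\<not> is_unit (gcd f g)" by (auto simp: is_unit_poly_iff)
  then have "f dvd gcd f g"
    using f by (meson gcd_dvd1 irreducibleD')
  then show ?thesis by auto
qed

definition conjugates :: "complex \<Rightarrow> complex set" where
  "conjugates a = {z. poly (map_poly of_int (int_min_poly a)) z = 0}"

lemma self_in_conjugates: "algebraic a \<Longrightarrow> a \<in> conjugates a"
  using poly_int_min_poly by (simp add: conjugates_def)

text \<open>A multiple root would make the minimal polynomial divide its own nonzero derivative,
  which has smaller degree.\<close>

lemma rsquarefree_int_min_poly:
  assumes "algebraic a"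
  shows "rsquarefree (map_poly of_int (int_min_poly a) :: complex poly)"
proof -
  let ?f = "int_min_poly a"
  have "\<not> (poly (map_poly of_int ?f) z = 0 \<and> poly (pderiv (map_poly of_int ?f)) z = 0)" for z :: complex
  proof
    assume z: "poly (map_poly of_int ?f) z = 0 \<and> poly (pderiv (map_poly of_int ?f)) z = 0"
    then have "poly (map_poly of_int (pderiv ?f)) z = 0"
      by (simp add: of_int_hom.map_poly_pderiv)
    then have dvd: "?f dvd pderiv ?f"
      using z irreducible_int_poly_dvd[OF irreducible_int_min_poly[OF assms]] by blast
    have "?f \<noteq> 0" using irreducible_int_min_poly[OF assms] by auto
    with z have "degree ?f > 0" using int_poly_root_nonconst by blast
    then have "pderiv ?f \<noteq> 0" by (simp add: pderiv_eq_0_iff)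
    with dvd have "degree ?f \<le> degree (pderiv ?f)" by (rule dvd_imp_degree_le)
    with \<open>degree ?f > 0\<close> show False by (simp add: degree_pderiv)
  qed
  then show ?thesis by (simp add: rsquarefree_roots)
qed

lemma int_min_poly_conjugates:
  assumes "algebraic a"
  shows "map_poly of_int (int_min_poly a)
    = smult (of_int (lead_coeff (int_min_poly a))) (\<Prod>z\<in>conjugates a. [:- z, 1:])"
  using complex_poly_decompose_rsquarefree[OF rsquarefree_int_min_poly[OF assms]]
  by (simp add: conjugates_def)

lemma finite_conjugates [simp]:
  assumes "algebraic a"
  shows "finite (conjugates a)"
  unfolding conjugates_def
  using irreducible_int_min_poly[OF assms] by (intro poly_roots_finite) auto

lemma card_conjugates:
  assumes "algebraic a"
  shows "card (conjugates a) = degree (int_min_poly a)"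
proof -
  have "degree (int_min_poly a) = degree (map_poly of_int (int_min_poly a) :: complex poly)"
    by simp
  also have "\<dots> = degree (\<Prod>z\<in>conjugates a. [:- z, 1:])"
    using lead_coeff_int_min_poly[OF assms]
    by (subst int_min_poly_conjugates[OF assms]) auto
  also have "\<dots> = card (conjugates a)"
    by (subst degree_prod_sum_eq) auto
  finally show ?thesis by simp
qed

lemma card_conjugates_pos: "algebraic a \<Longrightarrow> card (conjugates a) > 0"
  using self_in_conjugates[of a] finite_conjugates[of a] by (auto simp: card_gt_0_iff)

section \<open>Rational polynomial expressions, their conjugates and norms\<close>

global_interpretation of_rat_poly_hom: map_poly_inj_idom_hom "of_rat :: rat \<Rightarrow> complex" ..

text \<open>Elements of the number field generated by \<open>a\<close> are written
  \<open>rat_eval p a\<close>; the embeddings of the field then send this element to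
  \<open>rat_eval p z\<close> for \<open>z\<close> in \<open>conjugates a\<close>.\<close>

definition rat_eval :: "rat poly \<Rightarrow> complex \<Rightarrow> complex" where
  "rat_eval p z = poly (map_poly of_rat p) z"

lemma rat_eval_0 [simp]: "rat_eval 0 z = 0"
  and rat_eval_1 [simp]: "rat_eval 1 z = 1"
  and rat_eval_add [simp]: "rat_eval (p + q) z = rat_eval p z + rat_eval q z"
  and rat_eval_diff [simp]: "rat_eval (p - q) z = rat_eval p z - rat_eval q z"
  and rat_eval_uminus [simp]: "rat_eval (- p) z = - rat_eval p z"
  and rat_eval_mult [simp]: "rat_eval (p * q) z = rat_eval p z * rat_eval q z"
  and rat_eval_smult [simp]: "rat_eval (smult c p) z = of_rat c * rat_eval p z"
  and rat_eval_pCons [simp]: "rat_eval (pCons c p) z = of_rat c + z * rat_eval p z"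
  and rat_eval_pcompose [simp]: "rat_eval (pcompose p q) z = rat_eval p (rat_eval q z)"
  by (simp_all add: rat_eval_def of_rat_hom.hom_add of_rat_hom.hom_mult of_rat_poly_hom.hom_add of_rat_poly_hom.hom_mult
      of_rat_poly_hom.hom_minus of_rat_poly_hom.hom_uminus of_rat_hom.map_poly_pcompose poly_pcompose
      of_rat_hom.map_poly_hom_smult of_rat_hom.map_poly_pCons_hom)

lemma rat_eval_power [simp]: "rat_eval (p ^ n) z = rat_eval p z ^ n"
  by (induction n) auto

lemma rat_eval_sum: "rat_eval (sum f I) z = (\<Sum>i\<in>I. rat_eval (f i) z)"
  by (induction I rule: infinite_finite_induct) auto

lemma rat_eval_of_int: "rat_eval (map_poly of_int q) z = poly (map_poly of_int q) z"
  by (simp add: rat_eval_def map_poly_map_poly o_def)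

lemma rat_poly_clear_denominators:
  fixes p :: "rat poly"
  obtains d q where "d > 0" "p = smult d (map_poly of_int q)"
proof -
  have "\<exists>(D :: int) q. D > 0 \<and> smult (of_int D) p = map_poly of_int q"
  proof (induction p)
    case 0
    show ?case by (intro exI[of _ 1] exI[of _ 0]) simp
  next
    case (pCons a p)
    then obtain D q where Dq: "(D :: int) > 0" "smult (of_int D) p = map_poly of_int q" by blast
    obtain x y where xy: "a = of_int x / of_int y" "y > 0"
      by (metis quotient_of_denom_pos quotient_of_div surj_pair)
    have "smult (of_int (D * y)) p = smult (of_int y) (smult (of_int D) p)"
      by (simp add: mult.commute)
    also have "\<dots> = map_poly of_int (smult y q)"
      by (simp add: Dq of_int_hom.map_poly_hom_smult)
    finally have "smult (of_int (D * y)) (pCons a p) = map_poly of_int (pCons (x * D) (smult y q))"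
      using xy by (simp add: of_int_hom.map_poly_pCons_hom)
    with Dq xy show ?case by (intro exI[of _ "D * y"]) auto
  qed
  then obtain D q where Dq: "(D :: int) > 0" "smult (of_int D) p = map_poly of_int q" by blast
  then have "p = smult (1 / of_int D) (map_poly of_int q)"
    by (simp flip: Dq(2))
  with Dq(1) show ?thesis by (intro that[of "1 / of_int D" q]) auto
qed

text \<open>Both sides say that the minimal polynomial divides the numerator of \<open>p\<close>.
  This makes the embeddings well defined and carries algebraic relations from \<open>a\<close> to
  its conjugates.\<close>

lemma rat_eval_conjugate_eq_0_iff:
  assumes "algebraic a" "z \<in> conjugates a"
  shows "rat_eval p z = 0 \<longleftrightarrow> rat_eval p a = 0"
proof -
  obtain d q where dq: "d > 0" "p = smult d (map_poly of_int q)"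
    by (rule rat_poly_clear_denominators)
  have "rat_eval p y = 0 \<longleftrightarrow> int_min_poly a dvd q" if "y \<in> conjugates a" for y
  proof
    assume "rat_eval p y = 0"
    with dq have "poly (map_poly of_int q) y = 0" by (simp add: rat_eval_of_int)
    with that show "int_min_poly a dvd q"
      using irreducible_int_poly_dvd[OF irreducible_int_min_poly[OF assms(1)]]
      by (auto simp: conjugates_def)
  next
    assume "int_min_poly a dvd q"
    then obtain r where "q = int_min_poly a * r" by auto
    with that show "rat_eval p y = 0"
      by (simp add: dq rat_eval_of_int of_int_poly_hom.hom_mult conjugates_def)
  qed
  with assms self_in_conjugates show ?thesis by blast
qed

text \<open>A nonconstant common factor of \<open>p\<close> and the minimal polynomial would vanish
  at some conjugate, and then \<open>p\<close> would vanish at \<open>a\<close>. So the two are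
  coprime over the rationals, and Bezout gives the inverse.\<close>

lemma rat_eval_inverse:
  assumes "algebraic a" "rat_eval p a \<noteq> 0"
  obtains q where "rat_eval q a = inverse (rat_eval p a)"
proof -
  let ?f = "int_min_poly a"
  let ?m = "map_poly of_int ?f :: rat poly"
  have "?m \<noteq> 0" using irreducible_int_min_poly[OF assms(1)] by auto
  define g where "g = gcd p ?m"
  have "g \<noteq> 0" using \<open>?m \<noteq> 0\<close> by (simp add: g_def)
  have "degree g = 0"
  proof (rule ccontr)
    assume "degree g \<noteq> 0"
    then have "degree (map_poly of_rat g :: complex poly) \<noteq> 0" by simp
    then obtain z where z: "rat_eval g z = 0"
      unfolding rat_eval_def
      using fundamental_theorem_of_algebra_alt[of "map_poly of_rat g"]
      by (metis degree_pCons_0)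
    from g_def obtain r s where "p = g * r" "?m = g * s"
      by (metis dvd_def gcd_dvd1 gcd_dvd2)
    with z have "rat_eval p z = 0" "rat_eval ?m z = 0" by auto
    then have "z \<in> conjugates a" by (simp add: rat_eval_of_int conjugates_def)
    with \<open>rat_eval p z = 0\<close> show False
      using rat_eval_conjugate_eq_0_iff[OF assms(1)] assms(2) by blast
  qed
  with \<open>g \<noteq> 0\<close> have "is_unit g" by (simp add: is_unit_iff_degree)
  then have "Rings.coprime p ?m" by (simp only: g_def is_unit_gcd)
  then obtain u v where "u * p + v * ?m = 1"
    by (metis bezout_coefficients_fst_snd coprime_imp_gcd_eq_1)
  then have "rat_eval (u * p + v * ?m) a = 1" by simp
  moreover have "rat_eval ?m a = 0"
    using poly_int_min_poly[OF assms(1)] by (simp add: rat_eval_of_int)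
  ultimately have "rat_eval u a * rat_eval p a = 1" by simp
  then have "rat_eval u a = inverse (rat_eval p a)"
    by (metis inverse_unique mult.commute)
  with that show ?thesis by blast
qed

text \<open>Euclid's algorithm for the resultant, which is the product up to a rational factor.\<close>

lemma prod_rat_eval_roots_Rats:
  fixes m g :: "rat poly"
  assumes "m \<noteq> 0"
  shows "(\<Prod>z\<leftarrow>complex_roots_complex (map_poly of_rat m). rat_eval g z) \<in> \<rat>"
  using assms
proof (induction "degree m" arbitrary: m g rule: less_induct)
  case less
  let ?M = "map_poly of_rat m :: complex poly"
  define zs where "zs = complex_roots_complex ?M"
  have M: "?M = smult (lead_coeff ?M) (\<Prod>a\<leftarrow>zs. [:- a, 1:])"
    unfolding zs_def by (rule complex_roots(1)[symmetric])
  define r where "r = g mod m"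
  have root: "rat_eval m z = 0" if "z \<in> set zs" for z
  proof -
    have "poly ?M z = lead_coeff ?M * (\<Prod>a\<leftarrow>zs. z - a)"
      by (subst M) (simp add: poly_prod_list o_def)
    with that show ?thesis by (auto simp: rat_eval_def prod_list_zero_iff)
  qed
  have "rat_eval g z = rat_eval r z" if "z \<in> set zs" for z
  proof -
    have "rat_eval g z = rat_eval (g div m * m + r) z" by (simp add: r_def)
    then show ?thesis using root[OF that] by (simp only: rat_eval_add rat_eval_mult mult_zero_right add_0)
  qed
  then have gr: "(\<Prod>z\<leftarrow>zs. rat_eval g z) = (\<Prod>z\<leftarrow>zs. rat_eval r z)"
    by (intro arg_cong[of _ _ prod_list] map_cong) auto
  show ?case
  proof (cases "r = 0")
    case True
    \<comment> \<open>Every factor vanishes, so the product is 0, or 1 if there are no roots at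
      all.\<close>
    then have "(\<Prod>z\<leftarrow>zs. rat_eval g z) \<in> {0, 1}" by (simp add: gr) (cases zs; simp)
    then show ?thesis unfolding zs_def[symmetric] by (metis Rats_0 Rats_1 insertE singletonD)
  next
    case False
    let ?R = "map_poly of_rat r :: complex poly"
    define ws where "ws = complex_roots_complex ?R"
    have R: "?R = smult (lead_coeff ?R) (\<Prod>a\<leftarrow>ws. [:- a, 1:])"
      unfolding ws_def by (rule complex_roots(1)[symmetric])
    have "degree m \<noteq> 0"
    proof
      assume "degree m = 0"
      then have "is_unit m" using less.prems by (simp add: is_unit_iff_degree)
      with False show False by (simp add: r_def mod_eq_0_iff_dvd unit_imp_dvd)
    qed
    then have "degree r < degree m"
      unfolding r_def using degree_mod_less'[of m g] less.prems False by (auto simp: r_def)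
    \<comment> \<open>The roles are exchanged: the induction hypothesis concerns the values of
      \<open>m\<close> at the roots of \<open>r\<close>. Both products are the double product of
      root differences, up to sign and powers of leading coefficients.\<close>
    from less.hyps[OF this False, of m] have rat: "(\<Prod>w\<leftarrow>ws. rat_eval m w) \<in> \<rat>"
      by (simp add: ws_def)
    have ev: "poly (smult c (\<Prod>a\<leftarrow>as. [:- a, 1:])) z = c * (\<Prod>a\<leftarrow>as. z - a)" for c as and z :: complex
      by (induction as) (auto simp: algebra_simps)
    have m_eq: "rat_eval m w = lead_coeff ?M * (\<Prod>z\<leftarrow>zs. w - z)" for w
      unfolding rat_eval_def by (subst M, subst ev) simp
    have r_eq: "rat_eval r z = lead_coeff ?R * (\<Prod>w\<leftarrow>ws. z - w)" for z
      unfolding rat_eval_def by (subst R, subst ev) simp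
    have swap: "(\<Prod>z\<leftarrow>zs. \<Prod>w\<leftarrow>ws. z - w) = (-1) ^ (length zs * length ws) * (\<Prod>w\<leftarrow>ws. \<Prod>z\<leftarrow>zs. w - z)"
      for zs ws :: "complex list"
    proof (induction ws)
      case Nil
      show ?case by (induction zs) auto
    next
      case (Cons w ws)
      have "(\<Prod>z\<leftarrow>zs. \<Prod>w\<leftarrow>w # ws. z - w) = (\<Prod>z\<leftarrow>zs. z - w) * (\<Prod>z\<leftarrow>zs. \<Prod>w\<leftarrow>ws. z - w)"
        by (induction zs) (auto simp: algebra_simps)
      also have "(\<Prod>z\<leftarrow>zs. z - w) = (-1) ^ length zs * (\<Prod>z\<leftarrow>zs. w - z)"
        by (induction zs) (auto simp: algebra_simps)
      finally show ?case by (simp add: Cons power_add mult_ac)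
    qed
    have pm: "(\<Prod>x\<leftarrow>xs. c * f x) = c ^ length xs * (\<Prod>x\<leftarrow>xs. f x)" for c :: complex and f :: "complex \<Rightarrow> complex" and xs
      by (induction xs) auto
    define c where "c = lead_coeff ?M ^ length ws"
    have lc: "lead_coeff ?M \<noteq> 0" using less.prems by simp
    then have "c \<noteq> 0" by (simp add: c_def)
    have "(\<Prod>w\<leftarrow>ws. rat_eval m w) = c * (\<Prod>w\<leftarrow>ws. \<Prod>z\<leftarrow>zs. w - z)"
      unfolding m_eq by (simp only: pm c_def)
    then have P: "(\<Prod>w\<leftarrow>ws. \<Prod>z\<leftarrow>zs. w - z) = (\<Prod>w\<leftarrow>ws. rat_eval m w) / c"
      using \<open>c \<noteq> 0\<close> by simp
    have "(\<Prod>z\<leftarrow>zs. rat_eval r z) = lead_coeff ?R ^ length zs * (\<Prod>z\<leftarrow>zs. \<Prod>w\<leftarrow>ws. z - w)"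
      unfolding r_eq by (simp only: pm)
    also have "\<dots> = lead_coeff ?R ^ length zs * ((-1) ^ (length zs * length ws)
        * ((\<Prod>w\<leftarrow>ws. rat_eval m w) / c))"
      by (simp only: swap[of ws zs] P)
    also have "\<dots> \<in> \<rat>"
      using rat by (intro Rats_mult Rats_divide Rats_power) (auto simp: c_def intro!: Rats_power)
    finally show ?thesis using gr by (simp add: zs_def)
  qed
qed

text \<open>This is the norm of \<open>rat_eval p a\<close>. The list of roots with multiplicity is
  as long as there are conjugates, so it is distinct and the list product is the product over the
  set.\<close>

lemma prod_conjugates_Rats:
  assumes "algebraic a"
  shows "(\<Prod>z\<in>conjugates a. rat_eval p z) \<in> \<rat>"
proof -
  let ?m = "map_poly of_int (int_min_poly a) :: rat poly"
  let ?M = "map_poly of_rat ?m :: complex poly"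
  define zs where "zs = complex_roots_complex ?M"
  have nz: "?m \<noteq> 0" using irreducible_int_min_poly[OF assms] by auto
  have M: "?M = map_poly of_int (int_min_poly a)" by (simp add: map_poly_map_poly o_def)
  have dec: "?M = smult (lead_coeff ?M) (\<Prod>a\<leftarrow>zs. [:- a, 1:])"
    unfolding zs_def by (rule complex_roots(1)[symmetric])
  have nzM: "?M \<noteq> 0" using nz by simp
  have len: "length zs = degree (int_min_poly a)" unfolding zs_def complex_roots by simp
  have set: "set zs = conjugates a"
  proof -
    have "poly ?M z = lead_coeff ?M * (\<Prod>a\<leftarrow>zs. z - a)" for z
      by (subst dec) (simp add: poly_prod_list o_def)
    then have "z \<in> set zs \<longleftrightarrow> poly ?M z = 0" for z
      using nzM by (auto simp: prod_list_zero_iff)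
    then show ?thesis by (auto simp: conjugates_def M)
  qed
  have "distinct zs"
    using set len card_conjugates[OF assms] by (simp add: card_distinct)
  then have "(\<Prod>z\<in>conjugates a. rat_eval p z) = (\<Prod>z\<leftarrow>zs. rat_eval p z)"
    by (simp only: set[symmetric] prod.distinct_set_conv_list)
  then show ?thesis using prod_rat_eval_roots_Rats[OF nz, of p] by (simp add: zs_def)
qed

text \<open>Divided differences: for rational \<open>t\<close>, the quotient of
  \<open>p - p(t)\<close> by \<open>X - t\<close> has smaller degree and takes rational values at
  all rationals other than \<open>t\<close>. The induction therefore permits a finite exceptional
  set \<open>S\<close>, which grows by one point at each step.\<close>

lemma rat_poly_if_rat_values:
  fixes p :: "complex poly"
  assumes "\<And>t. t \<in> \<rat> \<Longrightarrow> poly p t \<in> \<rat>"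
  obtains q where "p = map_poly of_rat q"
proof -
  have "\<exists>q. p = map_poly of_rat q" if "finite S" "\<And>t. t \<in> \<rat> - S \<Longrightarrow> poly p t \<in> \<rat>" for S
    using that
  proof (induction "degree p" arbitrary: p S rule: less_induct)
    case less
    have "infinite (\<rat> :: complex set)"
    proof
      assume "finite (\<rat> :: complex set)"
      then have "finite (range (of_nat :: nat \<Rightarrow> complex))"
        by (rule rev_finite_subset) auto
      then show False using finite_imageD[of of_nat "UNIV :: nat set"] by (simp add: inj_of_nat)
    qed
    then have "infinite (\<rat> - S)" using less.prems(1) by auto
    then obtain t where t: "t \<in> \<rat>" "t \<notin> S" using infinite_imp_nonempty by blast
    obtain t' where t': "t = of_rat t'" using t(1) by (auto elim: Rats_cases)
    obtain y where y: "poly p t = of_rat y" using less.prems(2)[of t] t by (auto elim: Rats_cases)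
    show ?case
    proof (cases "degree p = 0")
      case True
      then obtain c where "p = [:c:]" by (rule degree_eq_zeroE)
      with y show ?thesis by (intro exI[of _ "[:y:]"]) (simp add: of_rat_hom.map_poly_pCons_hom)
    next
      case False
      have "[:- t, 1:] dvd p - [:poly p t:]"
        by (simp add: poly_eq_0_iff_dvd[symmetric] del: pCons_one)
      then obtain r where r: "p - [:poly p t:] = [:- t, 1:] * r" by (auto elim: dvdE)
      have "p - [:poly p t:] \<noteq> 0" using False by (metis degree_pCons_0 right_minus_eq)
      then have "r \<noteq> 0" using r by auto
      have "degree (- [:poly p t:]) < degree p" using False by simp
      from degree_add_eq_left[OF this] have "degree p = degree (p - [:poly p t:])"
        by (simp only: diff_conv_add_uminus)
      also have "\<dots> = 1 + degree r" unfolding r using \<open>r \<noteq> 0\<close> by (subst degree_mult_eq) auto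
      finally have deg: "degree r < degree p" by simp
      have "\<exists>q. r = map_poly of_rat q"
      proof (rule less.hyps[OF deg, of "insert t S"])
        fix s assume s: "s \<in> \<rat> - insert t S"
        have "poly p s - poly p t = (s - t) * poly r s"
          using arg_cong[OF r, of "\<lambda>p. poly p s"] by (simp add: algebra_simps)
        then have "poly r s = (poly p s - poly p t) / (s - t)" using s by auto
        also have "\<dots> \<in> \<rat>" using less.prems(2)[of s] less.prems(2)[of t] s t by auto
        finally show "poly r s \<in> \<rat>" .
      qed (use less.prems in auto)
      then obtain q where q: "r = map_poly of_rat q" ..
      have "p = [:of_rat y:] + [:- of_rat t', 1:] * map_poly of_rat q"
        using r by (simp add: q y[unfolded t'] t' algebra_simps)
      also have "\<dots> = map_poly of_rat ([:y:] + [:- t', 1:] * q)"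
        by (simp add: of_rat_poly_hom.hom_add of_rat_poly_hom.hom_mult of_rat_hom.hom_uminus
            of_rat_poly_hom.hom_minus of_rat_hom.map_poly_hom_smult of_rat_hom.map_poly_pCons_hom)
      finally show ?thesis by blast
    qed
  qed
  from this[of "{}"] assms that show ?thesis by blast
qed

text \<open>A nonconstant \<open>q\<close> shares a root with \<open>f\<close>, so \<open>f\<close>
  divides \<open>q\<close>, and the quotient inherits the hypothesis.\<close>

lemma int_poly_same_roots_power:
  fixes f q :: "int poly"
  assumes f: "irreducible f" and "q \<noteq> 0"
    and "\<And>z :: complex. poly (map_poly of_int q) z = 0 \<Longrightarrow> poly (map_poly of_int f) z = 0"
  shows "\<exists>c k. q = smult c (f ^ k)"
  using assms(2,3)
proof (induction "degree q" arbitrary: q rule: less_induct)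
  case less
  show ?case
  proof (cases "degree q = 0")
    case True
    then obtain c where "q = [:c:]" by (rule degree_eq_zeroE)
    then show ?thesis by (intro exI[of _ c] exI[of _ 0]) simp
  next
    case False
    then have "degree (map_poly of_int q :: complex poly) \<noteq> 0" by simp
    then obtain z :: complex where z: "poly (map_poly of_int q) z = 0"
      using fundamental_theorem_of_algebra_alt[of "map_poly of_int q"] by (metis degree_pCons_0)
    with less.prems have fz: "poly (map_poly of_int f) z = 0" by blast
    from irreducible_int_poly_dvd[OF f fz z] obtain r where r: "q = f * r" by auto
    with less.prems have "r \<noteq> 0" "f \<noteq> 0" by auto
    then have "degree r < degree q"
      using int_poly_root_nonconst[OF _ fz] by (simp add: r degree_mult_eq)
    moreover have "poly (map_poly of_int f) w = 0" if "poly (map_poly of_int r) w = 0" for w :: complex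
      using that less.prems(2)[of w] by (simp add: r of_int_poly_hom.hom_mult)
    ultimately obtain c k where "r = smult c (f ^ k)" using less.hyps[of r] \<open>r \<noteq> 0\<close> by blast
    then show ?thesis by (intro exI[of _ c] exI[of _ "Suc k"]) (simp add: r)
  qed
qed

text \<open>The characteristic polynomial of a field element is a power of its minimal polynomial,
  normalised to be monic; here \<open>P\<close> is the characteristic polynomial, and
  \<open>k\<close> is the degree of the field over the subfield that the element generates.\<close>

lemma int_min_poly_rat_eval_power:
  assumes a: "algebraic a" and b: "algebraic (rat_eval p a)"
  obtains k where "k * degree (int_min_poly (rat_eval p a)) = card (conjugates a)"
    "(map_poly of_int (int_min_poly (rat_eval p a)) :: complex poly) ^ k =
      smult (of_int (lead_coeff (int_min_poly (rat_eval p a)) ^ k)) (\<Prod>z\<in>conjugates a. [:- rat_eval p z, 1:])"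
proof -
  let ?f = "int_min_poly (rat_eval p a)"
  define P where "P = (\<Prod>z\<in>conjugates a. [:- rat_eval p z, 1:])"
  \<comment> \<open>The value at a rational \<open>t\<close> is the norm of
    \<open>t - rat_eval p a\<close>.\<close>
  have "poly P t \<in> \<rat>" if "t \<in> \<rat>" for t
  proof -
    from that obtain t' where t': "t = of_rat t'" by (auto elim: Rats_cases)
    have "poly P t = (\<Prod>z\<in>conjugates a. rat_eval ([:t':] - p) z)"
      by (simp add: P_def poly_prod t')
    then show ?thesis using prod_conjugates_Rats[OF a, of "[:t':] - p"] by simp
  qed
  then obtain q0 where q0: "P = map_poly of_rat q0" by (rule rat_poly_if_rat_values)
  obtain d q where dq: "d > 0" "q0 = smult d (map_poly of_int q)"
    by (rule rat_poly_clear_denominators)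
  have Pq: "P = smult (of_rat d) (map_poly of_int q)"
    unfolding q0 dq(2) by (simp add: of_rat_hom.map_poly_hom_smult map_poly_map_poly o_def)
  have "P \<noteq> 0" by (auto simp: P_def a)
  then have "q \<noteq> 0" using Pq by auto
  \<comment> \<open>The equation that the minimal polynomial kills \<open>rat_eval p a\<close> is a
    polynomial relation in \<open>a\<close>; conjugating it shows that each root of \<open>P\<close>
    is a root of \<open>?f\<close>.\<close>
  have "poly (map_poly of_int ?f) w = 0" if "poly (map_poly of_int q) w = 0" for w :: complex
  proof -
    have "poly P w = 0" using that by (simp add: Pq)
    then obtain z where z: "z \<in> conjugates a" "w = rat_eval p z"
      using a by (auto simp: P_def poly_prod)
    have "rat_eval (pcompose (map_poly of_int ?f) p) a = 0"
      using poly_int_min_poly[OF b] by (simp add: rat_eval_of_int)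
    then have "rat_eval (pcompose (map_poly of_int ?f) p) z = 0"
      using rat_eval_conjugate_eq_0_iff[OF a z(1)] by blast
    then show ?thesis by (simp add: rat_eval_of_int z)
  qed
  then obtain c k where ck: "q = smult c (?f ^ k)"
    using int_poly_same_roots_power[OF irreducible_int_min_poly[OF b] \<open>q \<noteq> 0\<close>] by blast
  let ?F = "map_poly of_int ?f :: complex poly"
  define e where "e = of_rat d * (of_int c :: complex)"
  have PF: "P = smult e (?F ^ k)"
    by (simp add: Pq ck e_def of_int_hom.map_poly_hom_smult of_int_poly_hom.hom_power)
  have "lead_coeff P = 1" unfolding P_def by (simp add: lead_coeff_prod)
  then have e: "e * of_int (lead_coeff ?f ^ k) = 1"
    unfolding PF lead_coeff_smult lead_coeff_power by simp
  have "?F ^ k = smult (e * of_int (lead_coeff ?f ^ k)) (?F ^ k)" by (simp only: e) simp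
  also have "\<dots> = smult (of_int (lead_coeff ?f ^ k)) P"
    by (simp add: PF mult_ac)
  finally have F: "?F ^ k = smult (of_int (lead_coeff ?f ^ k)) P" .
  have irr_nz: "?F \<noteq> 0" using irreducible_int_min_poly[OF b] by auto
  have "degree P = card (conjugates a)"
    unfolding P_def by (subst degree_prod_sum_eq) auto
  moreover have "degree P = k * degree ?f"
    unfolding PF using e degree_power_eq[OF irr_nz, of k] by auto
  ultimately show ?thesis using that[of k] F by (simp add: P_def)
qed

section \<open>Primitive elements and the Weil height\<close>

lemma algebraic_imp_int_multiple:
  fixes x :: complex
  assumes "algebraic x"
  obtains n :: int where "n \<noteq> 0" "algebraic_int (of_int n * x)"
proof -
  obtain q where q: "q \<noteq> 0" "poly (map_poly of_int q) x = 0"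
    using assms by (rule algebraicE')
  have "algebraic_int (lead_coeff (map_poly of_int q) * x)"
    using q by (intro algebraic_int_lead_coeff_mult_root alg_int_poly_map_of_int) auto
  with q that[of "lead_coeff q"] show ?thesis by simp
qed

lemma int_multiple_imp_algebraic:
  fixes x :: complex
  assumes "n \<noteq> 0" "algebraic_int (of_int n * x)"
  shows "algebraic x"
proof -
  obtain p where p: "lead_coeff p = 1" "\<forall>i. coeff p i \<in> \<int>" "poly p (of_int n * x) = 0"
    using assms(2) by (auto elim: algebraic_int.cases)
  show ?thesis
  proof (rule algebraicI)
    show "coeff (pcompose p [:0, of_int n:]) i \<in> \<int>" for i
      using p by (intro coeff_pcompose_semiring_closed) (auto simp: coeff_pCons split: nat.splits)
    show "pcompose p [:0, of_int n:] \<noteq> 0"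
      using p assms(1) by (subst pcompose_eq_0_iff) auto
    show "poly (pcompose p [:0, of_int n:]) x = 0"
      using p by (simp add: poly_pcompose mult.commute)
  qed
qed

lemma
  fixes x y :: complex
  assumes "algebraic x" "algebraic y"
  shows algebraic_add: "algebraic (x + y)" and algebraic_mult: "algebraic (x * y)"
proof -
  obtain n :: int where n: "n \<noteq> 0" "algebraic_int (of_int n * x)"
    using assms(1) by (rule algebraic_imp_int_multiple)
  obtain m :: int where m: "m \<noteq> 0" "algebraic_int (of_int m * y)"
    using assms(2) by (rule algebraic_imp_int_multiple)
  have nm: "n * m \<noteq> 0" using n m by simp
  have "algebraic_int (of_int m * (of_int n * x) + of_int n * (of_int m * y))"
    by (rule algebraic_int_add[OF algebraic_int_mult[OF algebraic_int_of_int n(2)]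
          algebraic_int_mult[OF algebraic_int_of_int m(2)]])
  then have "algebraic_int (of_int (n * m) * (x + y))" by (simp add: algebra_simps)
  with nm show "algebraic (x + y)" by (rule int_multiple_imp_algebraic)
  have "algebraic_int ((of_int n * x) * (of_int m * y))"
    by (rule algebraic_int_mult[OF n(2) m(2)])
  then have "algebraic_int (of_int (n * m) * (x * y))" by (simp add: algebra_simps)
  with nm show "algebraic (x * y)" by (rule int_multiple_imp_algebraic)
qed

lemma algebraic_divide: "algebraic (x :: complex) \<Longrightarrow> algebraic y \<Longrightarrow> algebraic (x / y)"
  using algebraic_mult[of x "inverse y"] by (simp add: divide_inverse algebraic_inverse)

lemma algebraic_power: "algebraic (x :: complex) \<Longrightarrow> algebraic (x ^ n)"
  by (induction n) (auto intro: algebraic_mult)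

lemma algebraic_of_rat: "algebraic (of_rat r :: complex)"
proof (cases r)
  case (Fract a b)
  have "algebraic (of_int a / of_int b :: complex)"
    by (intro algebraic_divide algebraic_int_imp_algebraic algebraic_int_of_int)
  with Fract show ?thesis by (simp add: of_rat_rat)
qed

lemma algebraic_rat_eval: "algebraic a \<Longrightarrow> algebraic (rat_eval p a)"
  by (induction p) (auto intro: algebraic_add algebraic_mult algebraic_of_rat)

section \<open>Number fields and primitive elements\<close>

definition rat_field :: "complex \<Rightarrow> complex set" where
  "rat_field a = range (\<lambda>p. rat_eval p a)"

lemma rat_field_self: "a \<in> rat_field a"
proof -
  have "rat_eval [:0, 1:] a = a" by simp
  then show ?thesis unfolding rat_field_def by (metis rangeI)
qed

lemma rat_field_of_rat: "of_rat r \<in> rat_field a"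
proof -
  have "rat_eval [:r:] a = of_rat r" by simp
  then show ?thesis unfolding rat_field_def by (metis rangeI)
qed

lemma rat_field_of_int: "of_int r \<in> rat_field a"
  using rat_field_of_rat[of "of_int r"] by simp

lemma rat_field_add: "x \<in> rat_field a \<Longrightarrow> y \<in> rat_field a \<Longrightarrow> x + y \<in> rat_field a"
  unfolding rat_field_def by (auto simp flip: rat_eval_add)

lemma rat_field_mult: "x \<in> rat_field a \<Longrightarrow> y \<in> rat_field a \<Longrightarrow> x * y \<in> rat_field a"
  unfolding rat_field_def by (auto simp flip: rat_eval_mult)

lemma rat_field_uminus: "x \<in> rat_field a \<Longrightarrow> - x \<in> rat_field a"
  unfolding rat_field_def by (auto simp flip: rat_eval_uminus)

lemma rat_field_diff: "x \<in> rat_field a \<Longrightarrow> y \<in> rat_field a \<Longrightarrow> x - y \<in> rat_field a"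
  unfolding rat_field_def by (auto simp flip: rat_eval_diff)

text \<open>Since inverses of polynomial expressions in an algebraic number are again such
  expressions, \<open>rat_field a\<close> is a field although it is defined without
  division.\<close>

lemma rat_field_inverse: 
  assumes "algebraic a" "x \<in> rat_field a"
  shows "inverse x \<in> rat_field a"
proof (cases "x = 0")
  case True
  then show ?thesis using assms by simp
next
  case False
  from assms obtain p where "x = rat_eval p a" by (auto simp: rat_field_def)
  with False rat_eval_inverse[OF assms(1)] show ?thesis
    unfolding rat_field_def by (metis rangeI)
qed

text \<open>The minimal polynomial of \<open>b\<close> over the field divides \<open>p\<close> and \<open>q\<close>, hence it is linear.\<close>

lemma unique_simple_common_root_in_rat_field:
  fixes p q :: "complex poly"
  assumes a: "algebraic a"
    and coeffs: "\<And>i. coeff p i \<in> rat_field a" "\<And>i. coeff q i \<in> rat_field a"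
    and root: "poly p b = 0" "poly q b = 0"
    and unique: "\<And>z. poly p z = 0 \<Longrightarrow> poly q z = 0 \<Longrightarrow> z = b"
    and simple: "poly (pderiv q) b \<noteq> 0"
  shows "b \<in> rat_field a"
proof -
  let ?K = "rat_field a"
  \<comment> \<open>\<open>Q n\<close> says that \<open>n\<close> is the degree of a monic
    polynomial over the field that kills \<open>b\<close>; the least such \<open>n\<close> belongs
    to the minimal polynomial \<open>r\<close>.\<close>
  define Q where "Q n \<longleftrightarrow> (\<exists>r. degree r = n \<and> lead_coeff r = 1 \<and> (\<forall>i. coeff r i \<in> ?K) \<and> poly r b = 0)" for n
  have monic: "Q (degree r)" if r: "r \<noteq> 0" "\<And>i. coeff r i \<in> ?K" "poly r b = 0" for r
    unfolding Q_def
    by (rule exI[of _ "smult (inverse (lead_coeff r)) r"])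
       (use r in \<open>auto intro: rat_field_mult rat_field_inverse[OF a]\<close>)
  have "q \<noteq> 0" using simple by auto
  then have "Q (degree q)" using coeffs root by (intro monic) auto
  define n where "n = (LEAST n. Q n)"
  have "Q n" unfolding n_def by (rule LeastI[of Q]) fact
  then obtain r where r: "degree r = n" "lead_coeff r = 1" "\<And>i. coeff r i \<in> ?K" "poly r b = 0"
    by (auto simp: Q_def)
  have "n > 0"
  proof (rule ccontr)
    assume "\<not> n > 0"
    then obtain c where "r = [:c:]" using r degree_eq_zeroE[of r] by auto
    with r show False by simp
  qed
  have dvd: "r dvd s" if "\<And>i. coeff s i \<in> ?K" "poly s b = 0" for s
    using that
  proof (induction "degree s" arbitrary: s rule: less_induct)
    case less
    show ?case
    proof (cases "s = 0")
      case False
      have "n \<le> degree s"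
        unfolding n_def by (rule Least_le) (use monic[OF False] less.prems in auto)
      define t where "t = monom (lead_coeff s) (degree s - n) * r"
      define s' where "s' = s - t"
      have ct: "coeff t i \<in> ?K" for i
        using less.prems(1) r(3) rat_field_of_int[of 0]
        by (auto simp: t_def coeff_monom_mult intro: rat_field_mult)
      have cs: "coeff s' i \<in> ?K" for i
        using less.prems(1) ct by (auto simp: s'_def intro: rat_field_diff)
      have rs: "poly s' b = 0" using less.prems r by (simp add: s'_def t_def)
      have "r dvd s'"
      proof (cases "s' = 0")
        case False
        have "r \<noteq> 0" using r by auto
        have "coeff t (degree s) = lead_coeff s"
          using r \<open>n \<le> degree s\<close> by (simp add: t_def coeff_monom_mult)
        then have "coeff s' (degree s) = 0" by (simp add: s'_def)
        moreover have "degree t = degree s"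
          using \<open>n \<le> degree s\<close> \<open>s \<noteq> 0\<close> \<open>r \<noteq> 0\<close> r
          by (simp add: t_def degree_mult_eq degree_monom_eq)
        then have "degree s' \<le> degree s" by (simp add: s'_def degree_diff_le)
        ultimately have "degree s' < degree s"
          using False by (metis le_neq_implies_less leading_coeff_0_iff)
        then show ?thesis using less.hyps cs rs by blast
      qed auto
      moreover have "r dvd t" by (simp add: t_def)
      moreover have "s = s' + t" by (simp add: s'_def)
      ultimately show ?thesis by (metis dvd_add)
    qed auto
  qed
  have rp: "r dvd p" and rq: "r dvd q" using dvd coeffs root by auto
  from r(4) obtain s where s: "r = [:- b, 1:] * s" by (auto simp: poly_eq_0_iff_dvd)
  have "s \<noteq> 0" using s r(2) by auto
  have "degree s = 0"
  proof (rule ccontr)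
    assume "degree s \<noteq> 0"
    \<comment> \<open>A second root of \<open>r\<close> would be a common root of \<open>p\<close>
      and \<open>q\<close>, hence equal to \<open>b\<close>, and then \<open>b\<close> would be a
      double root of \<open>q\<close>.\<close>
    then obtain z where z: "poly s z = 0"
      using fundamental_theorem_of_algebra_alt[of s] by (metis degree_pCons_0)
    then have "poly r z = 0" by (simp add: s)
    then have "z = b" using rp rq unique by (auto elim!: dvdE)
    with z obtain u where u: "s = [:- b, 1:] * u" by (auto simp: poly_eq_0_iff_dvd)
    obtain w where "q = r * w" using rq by auto
    then have "q = [:- b, 1:] * ([:- b, 1:] * (u * w))" using s u by (simp only: mult.assoc)
    then have "poly (pderiv q) b = 0" by (simp only: pderiv_mult poly_add poly_mult) simp
    with simple show False by simp
  qed
  then obtain c where c: "s = [:c:]" by (rule degree_eq_zeroE)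
  with r(2) s \<open>s \<noteq> 0\<close> have "c = 1" by (auto simp: degree_mult_eq)
  with c s have "coeff r 0 = - b" by simp
  then show ?thesis using r(3)[of 0] rat_field_uminus[of "- b" a] by simp
qed

text \<open>With \<open>c = a + t b\<close> for a suitable integer \<open>t\<close>, the number
  \<open>b\<close> is the only common root of its minimal polynomial and of
  \<open>F(c - t X)\<close>, where \<open>F\<close> is the minimal polynomial of
  \<open>a\<close>.\<close>

lemma primitive_element:
  assumes a: "algebraic a" and b: "algebraic b"
  obtains c where "algebraic c" "a \<in> rat_field c" "b \<in> rat_field c"
proof -
  \<comment> \<open>These are the values of \<open>t\<close> for which another pair of conjugates
    \<open>a'\<close>, \<open>b'\<close> with \<open>b' \<noteq> b\<close> gives the same
    \<open>c\<close>. Division by zero for \<open>b' = b\<close> only adds the value 0.\<close>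
  define S where "S = (\<lambda>(a', b'). (a' - a) / (b - b')) ` (conjugates a \<times> conjugates b)"
  have "finite S" using a b by (simp add: S_def)
  moreover have "infinite (range (of_int :: int \<Rightarrow> complex))"
    using finite_imageD[of "of_int :: int \<Rightarrow> complex" UNIV] by (auto simp: inj_on_def)
  ultimately obtain t :: int where t: "(of_int t :: complex) \<notin> S"
    by (meson finite_subset image_subsetI)
  define c where "c = a + of_int t * b"
  have c: "algebraic c"
    unfolding c_def
    by (intro algebraic_add algebraic_mult a b algebraic_int_imp_algebraic[OF algebraic_int_of_int])
  let ?F = "map_poly of_int (int_min_poly a) :: complex poly"
  let ?q = "map_poly of_int (int_min_poly b) :: complex poly"
  let ?p = "pcompose ?F [:c, - of_int t:]"
  have "b \<in> rat_field c"
  proof (rule unique_simple_common_root_in_rat_field[OF c, of ?p ?q])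
    show "coeff ?p i \<in> rat_field c" for i
      using rat_field_of_int[of 0] rat_field_of_int[of "- t"] rat_field_self
      by (intro coeff_pcompose_semiring_closed)
         (auto intro: rat_field_add rat_field_mult rat_field_of_int simp: coeff_map_poly coeff_pCons split: nat.splits)
    show "coeff ?q i \<in> rat_field c" for i
      by (simp add: coeff_map_poly rat_field_of_int)
    show "poly ?p b = 0" using poly_int_min_poly[OF a] by (simp add: poly_pcompose c_def algebra_simps)
    show "poly ?q b = 0" by (rule poly_int_min_poly[OF b])
    show "poly (pderiv ?q) b \<noteq> 0"
      using rsquarefree_int_min_poly[OF b] poly_int_min_poly[OF b] unfolding rsquarefree_roots by blast
  next
    fix z assume z: "poly ?p z = 0" "poly ?q z = 0"
    define a' where "a' = c - of_int t * z"
    have "a' \<in> conjugates a" "z \<in> conjugates b"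
      using z by (auto simp: conjugates_def poly_pcompose a'_def algebra_simps)
    then have "(a' - a) / (b - z) \<in> S" by (force simp: S_def)
    moreover have "a' - a = of_int t * (b - z)" by (simp add: a'_def c_def algebra_simps)
    ultimately show "z = b" using t by (cases "z = b") auto
  qed
  moreover have "a = c - of_int t * b" by (simp add: c_def)
  ultimately have "a \<in> rat_field c"
    by (auto intro: rat_field_diff rat_field_mult rat_field_of_int rat_field_self)
  with \<open>b \<in> rat_field c\<close> c that show ?thesis by blast
qed

lemma rat_field_trans: "x \<in> rat_field y \<Longrightarrow> y \<in> rat_field z \<Longrightarrow> x \<in> rat_field z"
  unfolding rat_field_def by (auto simp flip: rat_eval_pcompose)

lemma primitive_element3:
  assumes "algebraic a" "algebraic b" "algebraic c"
  obtains t p q r where "algebraic t" "a = rat_eval p t" "b = rat_eval q t" "c = rat_eval r t"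
proof -
  obtain s where s: "algebraic s" "a \<in> rat_field s" "b \<in> rat_field s"
    using primitive_element[OF assms(1,2)] .
  obtain t where t: "algebraic t" "s \<in> rat_field t" "c \<in> rat_field t"
    using primitive_element[OF s(1) assms(3)] .
  have "a \<in> rat_field t" "b \<in> rat_field t"
    using s t rat_field_trans by blast+
  with t that show ?thesis by (auto simp: rat_field_def)
qed

section \<open>Heights computed in a larger number field\<close>

lemma mahler_measure_poly_power: "mahler_measure_poly (p ^ n) = mahler_measure_poly p ^ n"
proof (induction n)
  case 0
  show ?case using mahler_measure_constant[of 1] by (simp add: one_pCons[symmetric])
qed (simp add: measure_eq_prod)

lemma mahler_measure_poly_linear_factors:
  assumes "finite Z"
  shows "mahler_measure_poly (smult c (\<Prod>z\<in>Z. [:- f z, 1:])) = cmod c * (\<Prod>z\<in>Z. max 1 (cmod (f z)))"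
proof -
  obtain zs where zs: "set zs = Z" "distinct zs" using finite_distinct_list[OF assms] by blast
  then show ?thesis
    using mahler_measure_poly_explicit[of c "map f zs"]
    by (simp add: prod.distinct_set_conv_list[symmetric] zs(1)[symmetric] o_def)
qed

lemma mahler_measure_int_min_poly_ge_1: "algebraic a \<Longrightarrow> mahler_measure (int_min_poly a) \<ge> 1"
  using irreducible_int_min_poly[of a] by (intro mahler_measure_poly_ge_1) auto

lemma degree_int_min_poly_pos: "algebraic a \<Longrightarrow> degree (int_min_poly a) > 0"
  using card_conjugates[of a] card_conjugates_pos[of a] by simp

lemma weil_height_nonneg: "algebraic a \<Longrightarrow> weil_height a \<ge> 0"
  using mahler_measure_int_min_poly_ge_1[of a] by (simp add: weil_height_def)

text \<open>The height can be computed over any field \<open>rat_field a\<close> containing the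
  number: the Mahler measure is multiplicative, and the exponent \<open>k\<close> from
  \<open>int_min_poly_rat_eval_power\<close> is absorbed by the larger number of conjugates.\<close>

lemma prod_max_conjugates:
  assumes a: "algebraic a"
    and k: "k * degree (int_min_poly (rat_eval p a)) = card (conjugates a)"
      "(map_poly of_int (int_min_poly (rat_eval p a)) :: complex poly) ^ k =
      smult (of_int (lead_coeff (int_min_poly (rat_eval p a)) ^ k)) (\<Prod>z\<in>conjugates a. [:- rat_eval p z, 1:])"
  shows "of_int (lead_coeff (int_min_poly (rat_eval p a)) ^ k) * (\<Prod>z\<in>conjugates a. max 1 (cmod (rat_eval p z)))
     = exp (real (card (conjugates a)) * weil_height (rat_eval p a))"
proof -
  have b: "algebraic (rat_eval p a)" using a by (rule algebraic_rat_eval)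
  let ?f = "int_min_poly (rat_eval p a)"
  have "of_int (lead_coeff ?f ^ k) * (\<Prod>z\<in>conjugates a. max 1 (cmod (rat_eval p z)))
    = mahler_measure_poly (map_poly of_int ?f ^ k)"
    unfolding k(2) using a lead_coeff_int_min_poly[OF b]
    by (subst mahler_measure_poly_linear_factors) (auto simp: norm_power)
  also have "\<dots> = mahler_measure ?f ^ k"
    by (simp add: mahler_measure_def mahler_measure_poly_power)
  also have "\<dots> = exp (real k * ln (mahler_measure ?f))"
    using mahler_measure_int_min_poly_ge_1[OF b] by (simp add: exp_of_nat_mult)
  also have "real k * ln (mahler_measure ?f) = real (card (conjugates a)) * weil_height (rat_eval p a)"
    using degree_int_min_poly_pos[OF b] by (simp add: weil_height_def k(1)[symmetric])
  finally show ?thesis .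
qed

text \<open>\<open>c\<close> is a power of the leading coefficient of the minimal polynomial: it clears the
  denominators of all products of conjugates with multiplicities at most one.\<close>

lemma weil_height_denominator:
  assumes a: "algebraic a"
  obtains c :: int where "c > 0"
    "of_int c * (\<Prod>z\<in>conjugates a. max 1 (cmod (rat_eval p z)))
     = exp (real (card (conjugates a)) * weil_height (rat_eval p a))"
    "\<And>e d. (\<And>z. z \<in> conjugates a \<Longrightarrow> e z \<le> d) \<Longrightarrow>
       algebraic_int (of_int (c ^ d) * (\<Prod>z\<in>conjugates a. rat_eval p z ^ e z))"
proof -
  have b: "algebraic (rat_eval p a)" using a by (rule algebraic_rat_eval)
  let ?Z = "conjugates a" and ?f = "int_min_poly (rat_eval p a)"
  obtain k where k: "k * degree ?f = card ?Z"
      "(map_poly of_int ?f :: complex poly) ^ k =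
      smult (of_int (lead_coeff ?f ^ k)) (\<Prod>z\<in>?Z. [:- rat_eval p z, 1:])"
    using int_min_poly_rat_eval_power[OF a b] .
  define c where "c = lead_coeff ?f ^ k"
  have "c > 0" using lead_coeff_int_min_poly[OF b] by (simp add: c_def)
  have "alg_int_poly (map_poly of_int (?f ^ k))" by (rule alg_int_poly_map_of_int)
  then have al: "alg_int_poly (smult (of_int c) (\<Prod>z\<in>?Z. [:- rat_eval p z, 1:]))"
    using k(2) by (simp add: of_int_poly_hom.hom_power c_def)
  have "algebraic_int (of_int (c ^ d) * (\<Prod>z\<in>?Z. rat_eval p z ^ e z))"
    if e: "\<And>z. z \<in> ?Z \<Longrightarrow> e z \<le> d" for e d
  proof -
    \<comment> \<open>The exponents are cut into \<open>d\<close> layers with multiplicities 0 or 1;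
      each layer is a product over a subset of the roots and is cleared by one factor
      \<open>c\<close>.\<close>
    have "(\<Prod>z\<in>?Z. rat_eval p z ^ e z) = (\<Prod>z\<in>?Z. \<Prod>j<d. if j < e z then rat_eval p z else 1)"
    proof (rule prod.cong, goal_cases)
      case (2 z)
      have "(\<Prod>j<d. if j < e z then rat_eval p z else 1) = (\<Prod>j<e z. rat_eval p z)"
        using e[OF 2] by (intro prod.mono_neutral_cong_right) auto
      then show ?case by simp
    qed auto
    also have "\<dots> = (\<Prod>j<d. \<Prod>z\<in>?Z. if j < e z then rat_eval p z else 1)"
      by (rule prod.swap)
    also have "of_int (c ^ d) * \<dots> = (\<Prod>j<d. of_int c * (\<Prod>z\<in>?Z. if j < e z then rat_eval p z else 1))"
      by (simp add: prod.distrib)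
    also have "\<dots> = (\<Prod>j<d. of_int c * (\<Prod>z | z \<in> ?Z \<and> j < e z. rat_eval p z))"
      using a by (simp add: prod.If_cases Int_def)
    also have "algebraic_int \<dots>"
      using a al by (intro algebraic_int_prod algebraic_int_lead_coeff_mult_prod_roots) auto
    finally show ?thesis .
  qed
  then show ?thesis
    using that[OF \<open>c > 0\<close>] prod_max_conjugates[OF a k] unfolding c_def by blast
qed

text \<open>By Bezout, the content is an integer combination of the coefficients.\<close>

lemma algebraic_int_mult_content:
  fixes p :: "int poly" and r :: complex
  assumes "\<And>i. algebraic_int (r * of_int (coeff p i))"
  shows "algebraic_int (r * of_int (content p))"
  using assms
proof (induction p)
  case 0
  show ?case by simp
next
  case (pCons a p)
  have "algebraic_int (r * of_int (coeff p i))" for i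
    using pCons.prems[of "Suc i"] by simp
  then have p: "algebraic_int (r * of_int (content p))" by (rule pCons.IH)
  have a: "algebraic_int (r * of_int a)" using pCons.prems[of 0] by simp
  obtain u v where uv: "u * a + v * content p = gcd a (content p)"
    using bezout_int by blast
  have c: "content (pCons a p) = gcd a (content p)"
    by (cases "a = 0 \<and> p = 0") (auto simp: content_def cCons_def)
  have "algebraic_int (of_int u * (r * of_int a) + of_int v * (r * of_int (content p)))"
    by (intro algebraic_int_add algebraic_int_mult a p algebraic_int_of_int)
  also have "of_int u * (r * of_int a) + of_int v * (r * of_int (content p))
      = r * of_int (u * a + v * content p)" by (simp add: algebra_simps)
  finally show ?case unfolding uv c .
qed

text \<open>The number \<open>c\<close> is allowed to be a root of a rational for use with the heights of powers.\<close>

lemma weil_height_divide_le: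
  assumes a: "algebraic a" and nz: "rat_eval q a \<noteq> 0"
    and c: "c \<noteq> 0" "c ^ m \<in> \<rat>" "m > 0"
    and al: "alg_int_poly (smult c (\<Prod>z\<in>conjugates a. [:- rat_eval p z, rat_eval q z:]))"
  shows "exp (real (card (conjugates a)) * weil_height (rat_eval p a / rat_eval q a))
    \<le> cmod c * (\<Prod>z\<in>conjugates a. max (cmod (rat_eval q z)) (cmod (rat_eval p z)))"
proof -
  let ?Z = "conjugates a"
  obtain q' where q': "rat_eval q' a = inverse (rat_eval q a)"
    using rat_eval_inverse[OF a nz] .
  define r where "r = p * q'"
  have r: "rat_eval r a = rat_eval p a / rat_eval q a"
    by (simp add: r_def q' divide_inverse)
  have qz: "rat_eval q z \<noteq> 0" if "z \<in> ?Z" for z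
    using nz rat_eval_conjugate_eq_0_iff[OF a that] by blast
  have pz: "rat_eval p z = rat_eval q z * rat_eval r z" if "z \<in> ?Z" for z
  proof -
    have "rat_eval (p - q * r) a = 0" using r nz by simp
    then have "rat_eval (p - q * r) z = 0" using rat_eval_conjugate_eq_0_iff[OF a that] by blast
    then show ?thesis by simp
  qed
  have b: "algebraic (rat_eval r a)" using a by (rule algebraic_rat_eval)
  let ?f = "int_min_poly (rat_eval r a)"
  obtain k where k: "k * degree ?f = card ?Z"
      "(map_poly of_int ?f :: complex poly) ^ k =
      smult (of_int (lead_coeff ?f ^ k)) (\<Prod>z\<in>?Z. [:- rat_eval r z, 1:])"
    using int_min_poly_rat_eval_power[OF a b] .
  define l where "l = lead_coeff ?f ^ k"
  have "l > 0" using lead_coeff_int_min_poly[OF b] by (simp add: l_def)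
  define N where "N = (\<Prod>z\<in>?Z. rat_eval q z)"
  have "N \<noteq> 0" using qz a by (simp add: N_def)
  have "N \<in> \<rat>" unfolding N_def by (rule prod_conjugates_Rats[OF a])
  \<comment> \<open>Up to the factor \<open>s\<close>, the polynomial in \<open>al\<close> is a
    power of the minimal polynomial, which is primitive by Gauss's lemma; integrality of the
    coefficients then makes \<open>s\<close> an algebraic integer.\<close>
  define s where "s = c * N / of_int l"
  have "(\<Prod>z\<in>?Z. [:- rat_eval p z, rat_eval q z:]) = (\<Prod>z\<in>?Z. smult (rat_eval q z) [:- rat_eval r z, 1:])"
    by (intro prod.cong) (auto simp: pz)
  also have "\<dots> = smult N (\<Prod>z\<in>?Z. [:- rat_eval r z, 1:])"
    by (simp only: prod_smult N_def)
  also have "smult c \<dots> = smult s (smult (of_int l) (\<Prod>z\<in>?Z. [:- rat_eval r z, 1:]))"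
    using \<open>l > 0\<close> by (simp add: s_def)
  also have "\<dots> = smult s (map_poly of_int (?f ^ k))"
    using k(2) by (simp add: l_def of_int_poly_hom.hom_power)
  finally have "alg_int_poly (smult s (map_poly of_int (?f ^ k)))"
    using al by simp
  then have "algebraic_int (s * of_int (content (?f ^ k)))"
    by (intro algebraic_int_mult_content) (auto simp: alg_int_poly_def coeff_map_poly)
  moreover have "content ?f = 1"
    using irreducible_int_min_poly[OF b] degree_int_min_poly_pos[OF b] irreducible_imp_primitive[of ?f]
    by (simp add: is_unit_content_iff)
  then have "content (?f ^ k) = 1" by (induction k) (simp_all add: content_mult)
  ultimately have "algebraic_int s" by simp
  \<comment> \<open>Being a rational algebraic integer and nonzero, \<open>s ^ m\<close> is a
    nonzero integer, so \<open>cmod s\<close> is at least 1. The factor \<open>cmod s\<close> is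
    exactly what the inequality loses.\<close>
  then have "algebraic_int (s ^ m)" by (rule algebraic_int_power)
  moreover have "s ^ m = c ^ m * (N / of_int l) ^ m"
    by (simp add: s_def power_mult_distrib power_divide)
  then have "s ^ m \<in> \<rat>"
    using c \<open>N \<in> \<rat>\<close> by auto
  ultimately have "s ^ m \<in> \<int>" by (intro rational_algebraic_int_is_int)
  then obtain i where i: "s ^ m = of_int i" by (auto elim: Ints_cases)
  have "s \<noteq> 0" using c \<open>N \<noteq> 0\<close> \<open>l > 0\<close> by (simp add: s_def)
  with i have "i \<noteq> 0" by auto
  then have "cmod s ^ m \<ge> 1" by (simp flip: norm_power add: i)
  then have s: "cmod s \<ge> 1"
    using power_less_one_iff[of "cmod s" m] c(3) by (metis norm_ge_zero not_le power_less_one_iff zero_less_iff_neq_zero le_less_linear)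
  have "cmod c * (\<Prod>z\<in>?Z. max (cmod (rat_eval q z)) (cmod (rat_eval p z)))
     = cmod c * (\<Prod>z\<in>?Z. cmod (rat_eval q z) * max 1 (cmod (rat_eval r z)))"
    by (intro arg_cong[of _ _ "\<lambda>x. cmod c * x"] prod.cong)
       (auto simp: pz norm_mult max_mult_distrib_left)
  also have "\<dots> = cmod s * (of_int l * (\<Prod>z\<in>?Z. max 1 (cmod (rat_eval r z))))"
    using \<open>l > 0\<close> by (simp add: prod.distrib s_def norm_divide norm_mult N_def prod_norm)
  also have "of_int l * (\<Prod>z\<in>?Z. max 1 (cmod (rat_eval r z)))
      = exp (real (card ?Z) * weil_height (rat_eval r a))"
    unfolding l_def by (rule prod_max_conjugates[OF a k])
  finally have eq: "cmod c * (\<Prod>z\<in>?Z. max (cmod (rat_eval q z)) (cmod (rat_eval p z)))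
     = cmod s * exp (real (card ?Z) * weil_height (rat_eval r a))" .
  show ?thesis unfolding eq r[symmetric] using s by simp
qed

section \<open>Inequalities for the Weil height\<close>

text \<open>Expanding the product over all choice functions \<open>g\<close> reduces integrality to
  the single products of monomials, where the denominators are known.\<close>

lemma alg_int_poly_prod_expand:
  assumes "finite Z" "finite I" "\<And>i. i \<in> I \<Longrightarrow> alg_int_poly (u i)"
    and "\<And>g. g \<in> (\<Pi>\<^sub>E z\<in>Z. I) \<Longrightarrow> algebraic_int (c * (\<Prod>z\<in>Z. w (g z) z))"
  shows "alg_int_poly (smult c (\<Prod>z\<in>Z. \<Sum>i\<in>I. smult (w i z) (u i)))"
proof -
  have "(\<Prod>z\<in>Z. \<Sum>i\<in>I. smult (w i z) (u i)) = (\<Sum>g\<in>(\<Pi>\<^sub>E z\<in>Z. I). \<Prod>z\<in>Z. smult (w (g z) z) (u (g z)))"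
    using assms by (subst prod_sum_PiE) auto
  also have "\<dots> = (\<Sum>g\<in>(\<Pi>\<^sub>E z\<in>Z. I). smult (\<Prod>z\<in>Z. w (g z) z) (\<Prod>z\<in>Z. u (g z)))"
    by (simp only: prod_smult)
  also have "smult c \<dots> = (\<Sum>g\<in>(\<Pi>\<^sub>E z\<in>Z. I). smult (c * (\<Prod>z\<in>Z. w (g z) z)) (\<Prod>z\<in>Z. u (g z)))"
    by (simp add: smult_sum2)
  also have "alg_int_poly \<dots>"
    using assms by (intro alg_int_poly_sum alg_int_poly_smult alg_int_poly_prod) auto
  finally show ?thesis .
qed

lemma cmod_sum_monomials_le:
  fixes x y z :: complex
  assumes "finite I" "\<And>i. i \<in> I \<Longrightarrow> e i \<le> d \<and> e' i \<le> d' \<and> e'' i \<le> d''"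
    and "(\<Sum>i\<in>I. real_of_int \<bar>F i\<bar>) \<le> C"
  shows "cmod (\<Sum>i\<in>I. of_int (F i) * (x ^ e i * y ^ e' i * z ^ e'' i))
    \<le> C * (max 1 (cmod x) ^ d * max 1 (cmod y) ^ d' * max 1 (cmod z) ^ d'')"
proof -
  let ?M = "max 1 (cmod x) ^ d * max 1 (cmod y) ^ d' * max 1 (cmod z) ^ d''"
  have pow: "cmod x ^ e \<le> max 1 (cmod x) ^ d" if "e \<le> d" for x e d
  proof -
    have "cmod x ^ e \<le> max 1 (cmod x) ^ e" by (intro power_mono) auto
    also have "\<dots> \<le> max 1 (cmod x) ^ d" using that by (intro power_increasing) auto
    finally show ?thesis .
  qed
  have "cmod (\<Sum>i\<in>I. of_int (F i) * (x ^ e i * y ^ e' i * z ^ e'' i))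
      \<le> (\<Sum>i\<in>I. cmod (of_int (F i) * (x ^ e i * y ^ e' i * z ^ e'' i)))"
    by (rule norm_sum)
  also have "\<dots> \<le> (\<Sum>i\<in>I. real_of_int \<bar>F i\<bar> * ?M)"
  proof (rule sum_mono)
    fix i assume i: "i \<in> I"
    have "cmod x ^ e i * cmod y ^ e' i * cmod z ^ e'' i \<le> ?M"
      using assms(2)[OF i] by (intro mult_mono pow) auto
    then show "cmod (of_int (F i) * (x ^ e i * y ^ e' i * z ^ e'' i)) \<le> real_of_int \<bar>F i\<bar> * ?M"
      by (simp add: norm_mult norm_power mult_left_mono)
  qed
  also have "\<dots> = (\<Sum>i\<in>I. real_of_int \<bar>F i\<bar>) * ?M" by (rule sum_distrib_right[symmetric])
  also have "\<dots> \<le> C * ?M" using assms(3) by (intro mult_right_mono) auto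
  finally show ?thesis .
qed

text \<open>The common source of the upper bounds below. Numerator and denominator are treated as
  one projective point over the same monomials, so that each height enters once and not twice.
  Denominators are cleared by an integer, and absolute values are bounded by the triangle inequality
  at each embedding.\<close>

lemma weil_height_quotient_le:
  fixes a b x :: complex
  assumes alg: "algebraic a" "algebraic b" "algebraic x" and I: "finite I"
    and e: "\<And>i. i \<in> I \<Longrightarrow> e i \<le> d \<and> e' i \<le> d' \<and> e'' i \<le> d''"
    and FC: "(\<Sum>i\<in>I. real_of_int \<bar>F i\<bar>) \<le> C" and GC: "(\<Sum>i\<in>I. real_of_int \<bar>G i\<bar>) \<le> C"
    and nz: "(\<Sum>i\<in>I. of_int (G i) * (a ^ e i * b ^ e' i * x ^ e'' i)) \<noteq> 0"
  shows "weil_height ((\<Sum>i\<in>I. of_int (F i) * (a ^ e i * b ^ e' i * x ^ e'' i)) /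
      (\<Sum>i\<in>I. of_int (G i) * (a ^ e i * b ^ e' i * x ^ e'' i)))
    \<le> real d * weil_height a + real d' * weil_height b + real d'' * weil_height x + ln C"
proof -
  obtain t p q r where t: "algebraic t" and pqr: "a = rat_eval p t" "b = rat_eval q t" "x = rat_eval r t"
    using primitive_element3[OF alg] .
  let ?Z = "conjugates t"
  define D where "D = real (card ?Z)"
  have "D > 0" using card_conjugates_pos[OF t] by (simp add: D_def)
  define w where "w i z = rat_eval p z ^ e i * rat_eval q z ^ e' i * rat_eval r z ^ e'' i" for i z
  define P where "P H = (\<Sum>i\<in>I. smult (of_int (H i)) (p ^ e i * q ^ e' i * r ^ e'' i))" for H
  have P: "rat_eval (P H) z = (\<Sum>i\<in>I. of_int (H i) * w i z)" for H z
    by (simp add: P_def w_def rat_eval_sum)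
  have Pt: "rat_eval (P H) t = (\<Sum>i\<in>I. of_int (H i) * (a ^ e i * b ^ e' i * x ^ e'' i))" for H
    by (simp add: P w_def pqr)
  obtain k :: int where k: "k > 0"
    "of_int k * (\<Prod>z\<in>?Z. max 1 (cmod (rat_eval p z))) = exp (D * weil_height a)"
    "\<And>e d. (\<And>z. z \<in> ?Z \<Longrightarrow> e z \<le> d) \<Longrightarrow> algebraic_int (of_int (k ^ d) * (\<Prod>z\<in>?Z. rat_eval p z ^ e z))"
    using weil_height_denominator[OF t, of p] unfolding D_def pqr by blast
  obtain l :: int where l: "l > 0"
    "of_int l * (\<Prod>z\<in>?Z. max 1 (cmod (rat_eval q z))) = exp (D * weil_height b)"
    "\<And>e d. (\<And>z. z \<in> ?Z \<Longrightarrow> e z \<le> d) \<Longrightarrow> algebraic_int (of_int (l ^ d) * (\<Prod>z\<in>?Z. rat_eval q z ^ e z))"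
    using weil_height_denominator[OF t, of q] unfolding D_def pqr by blast
  obtain m :: int where m: "m > 0"
    "of_int m * (\<Prod>z\<in>?Z. max 1 (cmod (rat_eval r z))) = exp (D * weil_height x)"
    "\<And>e d. (\<And>z. z \<in> ?Z \<Longrightarrow> e z \<le> d) \<Longrightarrow> algebraic_int (of_int (m ^ d) * (\<Prod>z\<in>?Z. rat_eval r z ^ e z))"
    using weil_height_denominator[OF t, of r] unfolding D_def pqr by blast
  \<comment> \<open>One integer clears the denominators of all monomials, whichever monomial is
    chosen at each conjugate.\<close>
  define c where "c = k ^ d * l ^ d' * m ^ d''"
  have "c > 0" using k l m by (simp add: c_def)
  have "alg_int_poly (smult (of_int c) (\<Prod>z\<in>?Z. \<Sum>i\<in>I. smult (w i z) [:- of_int (F i), of_int (G i):]))"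
  proof (rule alg_int_poly_prod_expand)
    show "alg_int_poly [:- of_int (F i), of_int (G i):]" for i
      using alg_int_poly_map_of_int[of "[:- F i, G i:]"] by (simp add: of_int_hom.map_poly_pCons_hom)
  next
    fix g assume "g \<in> (\<Pi>\<^sub>E z\<in>?Z. I)"
    then have g: "g z \<in> I" if "z \<in> ?Z" for z using that by auto
    have "algebraic_int ((of_int (k ^ d) * (\<Prod>z\<in>?Z. rat_eval p z ^ e (g z)))
        * (of_int (l ^ d') * (\<Prod>z\<in>?Z. rat_eval q z ^ e' (g z)))
        * (of_int (m ^ d'') * (\<Prod>z\<in>?Z. rat_eval r z ^ e'' (g z))))"
      using e g by (intro algebraic_int_mult k l m) blast+
    also have "\<dots> = of_int c * (\<Prod>z\<in>?Z. w (g z) z)"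
      by (simp add: w_def prod.distrib c_def mult_ac)
    finally show "algebraic_int \<dots>" .
  qed (use t I in auto)
  also have "(\<Prod>z\<in>?Z. \<Sum>i\<in>I. smult (w i z) [:- of_int (F i), of_int (G i):])
      = (\<Prod>z\<in>?Z. [:- rat_eval (P F) z, rat_eval (P G) z:])"
  proof (rule prod.cong)
    fix z
    have sum2: "(\<Sum>i\<in>I. [:f i, g i:]) = [:sum f I, sum g I:]" for f g :: "'a \<Rightarrow> complex"
      by (induction I rule: infinite_finite_induct) auto
    show "(\<Sum>i\<in>I. smult (w i z) [:- of_int (F i), of_int (G i):]) = [:- rat_eval (P F) z, rat_eval (P G) z:]"
      by (simp add: P sum2 sum_negf mult.commute)
  qed auto
  finally have al: "alg_int_poly (smult (of_int c) \<dots>)" .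
  have bound: "cmod (rat_eval (P H) z) \<le> C * (max 1 (cmod (rat_eval p z)) ^ d
      * max 1 (cmod (rat_eval q z)) ^ d' * max 1 (cmod (rat_eval r z)) ^ d'')"
    if "(\<Sum>i\<in>I. real_of_int \<bar>H i\<bar>) \<le> C" for H z
    unfolding P w_def by (rule cmod_sum_monomials_le[OF I e that])
  have "exp (D * weil_height (rat_eval (P F) t / rat_eval (P G) t))
    \<le> cmod (of_int c) * (\<Prod>z\<in>?Z. max (cmod (rat_eval (P G) z)) (cmod (rat_eval (P F) z)))"
    unfolding D_def
    by (rule weil_height_divide_le[OF t _ _ _ _ al, of 1]) (use nz \<open>c > 0\<close> in \<open>auto simp: Pt\<close>)
  also have "\<dots> \<le> of_int c * (\<Prod>z\<in>?Z. C * (max 1 (cmod (rat_eval p z)) ^ d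
      * max 1 (cmod (rat_eval q z)) ^ d' * max 1 (cmod (rat_eval r z)) ^ d''))"
    using \<open>c > 0\<close> bound[OF FC] bound[OF GC]
    by (auto simp: le_max_iff_disj intro!: mult_left_mono prod_mono)
  also have "\<dots> = C ^ card ?Z * ((of_int k * (\<Prod>z\<in>?Z. max 1 (cmod (rat_eval p z)))) ^ d
      * (of_int l * (\<Prod>z\<in>?Z. max 1 (cmod (rat_eval q z)))) ^ d'
      * (of_int m * (\<Prod>z\<in>?Z. max 1 (cmod (rat_eval r z)))) ^ d'')"
    by (simp add: prod.distrib c_def power_mult_distrib prod_power_distrib mult_ac)
  also have "\<dots> = C ^ card ?Z * (exp (D * weil_height a) ^ d * exp (D * weil_height b) ^ d' * exp (D * weil_height x) ^ d'')"
    by (simp only: k l m)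
  \<comment> \<open>The nonzero denominator forces some \<open>G i \<noteq> 0\<close>, hence
    \<open>C > 0\<close>, as the passage to \<open>ln C\<close> requires.\<close>
  also have "C ^ card ?Z = exp (D * ln C)"
  proof -
    have "\<exists>i\<in>I. G i \<noteq> 0"
    proof (rule ccontr)
      assume "\<not> ?thesis"
      then have "(\<Sum>i\<in>I. of_int (G i) * (a ^ e i * b ^ e' i * x ^ e'' i)) = 0"
        by (intro sum.neutral) auto
      with nz show False by contradiction
    qed
    then obtain i where "i \<in> I" "G i \<noteq> 0" by blast
    then have "0 < (\<Sum>i\<in>I. real_of_int \<bar>G i\<bar>)"
      using I by (intro sum_pos2[of I i]) auto
    then have "C > 0" using GC by linarith
    then show ?thesis by (simp add: D_def exp_of_nat_mult)
  qed
  also have "exp (D * ln C) * (exp (D * weil_height a) ^ d * exp (D * weil_height b) ^ d' * exp (D * weil_height x) ^ d'')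
      = exp (D * (real d * weil_height a + real d' * weil_height b + real d'' * weil_height x + ln C))"
    by (simp add: exp_of_nat_mult[symmetric] exp_add[symmetric] algebra_simps)
  finally show ?thesis using \<open>D > 0\<close> by (simp add: Pt)
qed

text \<open>If \<open>c\<close> clears the denominators of products of conjugates of
  \<open>x ^ q\<close>, then its real root \<open>r\<close> of order \<open>q\<close> clears those
  of \<open>x\<close>, because a number is an algebraic integer once a positive power of it is. The
  factor \<open>r\<close> is the reason for the form of
  \<open>weil_height_divide_le\<close>.\<close>

lemma weil_height_power_ge:
  assumes x: "algebraic x" and "q > 0"
  shows "real q * weil_height x \<le> weil_height (x ^ q)"
proof -
  let ?Z = "conjugates x" and ?X = "[:0, 1:] :: rat poly"
  have X: "rat_eval ?X z = z" for z by simp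
  define D where "D = real (card ?Z)"
  have "D > 0" using card_conjugates_pos[OF x] by (simp add: D_def)
  obtain c :: int where c: "c > 0"
    "of_int c * (\<Prod>z\<in>?Z. max 1 (cmod (rat_eval (?X ^ q) z))) = exp (D * weil_height (rat_eval (?X ^ q) x))"
    "\<And>e d. (\<And>z. z \<in> ?Z \<Longrightarrow> e z \<le> d) \<Longrightarrow> algebraic_int (of_int (c ^ d) * (\<Prod>z\<in>?Z. rat_eval (?X ^ q) z ^ e z))"
    using weil_height_denominator[OF x, of "?X ^ q"] unfolding D_def by blast
  define r where "r = root q (of_int c)"
  have r: "r > 0" "r ^ q = of_int c" using c \<open>q > 0\<close> by (simp_all add: r_def)
  \<comment> \<open>The factor \<open>[:- z, 1:]\<close> is split as \<open>X\<close> times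
    \<open>z ^ 0\<close> plus \<open>-1\<close> times \<open>z ^ 1\<close> to fit the expansion
    lemma.\<close>
  have "alg_int_poly (smult (of_real r) (\<Prod>z\<in>?Z. \<Sum>i\<in>{0, 1}. smult (z ^ i) (if i = 0 then [:0, 1:] else [:- 1:])))"
  proof (rule alg_int_poly_prod_expand)
    show "alg_int_poly (if i = 0 then [:0, 1:] else [:- 1:])" if "i \<in> {0, 1}" for i :: nat
      using alg_int_poly_map_of_int[of "[:0, 1:]"] alg_int_poly_map_of_int[of "[:- 1:]"]
      by (auto simp: of_int_hom.map_poly_pCons_hom)
  next
    fix g assume g: "g \<in> (\<Pi>\<^sub>E z\<in>?Z. {0, 1 :: nat})"
    have "(of_real r * (\<Prod>z\<in>?Z. z ^ g z)) ^ q = of_int (c ^ 1) * (\<Prod>z\<in>?Z. rat_eval (?X ^ q) z ^ g z)"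
      by (simp add: power_mult_distrib prod_power_distrib r flip: of_real_power power_mult)
         (simp add: mult.commute)
    moreover have "g z \<le> 1" if "z \<in> ?Z" for z
    proof -
      have "g z \<in> {0, 1}" using g that by (rule PiE_mem)
      then show ?thesis by auto
    qed
    ultimately have "algebraic_int ((of_real r * (\<Prod>z\<in>?Z. z ^ g z)) ^ q)"
      using c(3)[of g 1] by simp
    then show "algebraic_int (of_real r * (\<Prod>z\<in>?Z. z ^ g z))"
      using \<open>q > 0\<close> by (rule algebraic_int_power_cancel)
  qed (use x in auto)
  then have al: "alg_int_poly (smult (of_real r) (\<Prod>z\<in>?Z. [:- rat_eval ?X z, rat_eval 1 z:]))"
    by simp
  have "exp (D * weil_height (rat_eval ?X x / rat_eval 1 x))
    \<le> cmod (of_real r) * (\<Prod>z\<in>?Z. max (cmod (rat_eval 1 z)) (cmod (rat_eval ?X z)))"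
    unfolding D_def
    by (rule weil_height_divide_le[OF x _ _ _ \<open>q > 0\<close> al])
       (use r in \<open>auto simp flip: of_real_power\<close>)
  then have "exp (D * weil_height x) \<le> r * (\<Prod>z\<in>?Z. max 1 (cmod z))"
    using r by simp
  then have "exp (D * weil_height x) ^ q \<le> (r * (\<Prod>z\<in>?Z. max 1 (cmod z))) ^ q"
    by (intro power_mono) auto
  also have "\<dots> = of_int c * (\<Prod>z\<in>?Z. max 1 (cmod z) ^ q)"
    by (simp add: power_mult_distrib prod_power_distrib r)
  also have "(\<Prod>z\<in>?Z. max 1 (cmod z) ^ q) = (\<Prod>z\<in>?Z. max 1 (cmod (rat_eval (?X ^ q) z)))"
  proof (rule prod.cong)
    fix z :: complex
    have "max 1 (cmod z) ^ q = max 1 (cmod z ^ q)"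
    proof (cases "cmod z \<le> 1")
      case True
      then show ?thesis by (simp add: power_le_one max_absorb1)
    next
      case False
      then show ?thesis by (simp add: one_le_power max_absorb2)
    qed
    then show "max 1 (cmod z) ^ q = max 1 (cmod (rat_eval (?X ^ q) z))" by (simp add: norm_power)
  qed auto
  also have "of_int c * \<dots> = exp (D * weil_height (x ^ q))" using c(2) by simp
  finally have "D * (real q * weil_height x) \<le> D * weil_height (x ^ q)"
    by (simp add: mult_ac flip: exp_of_nat_mult)
  with \<open>D > 0\<close> show ?thesis by simp
qed

section \<open>Height of products, inverses, powers and simple fractions\<close>

lemma weil_height_mult_le:
  assumes "algebraic a" "algebraic b"
  shows "weil_height (a * b) \<le> weil_height a + weil_height b"
  \<comment> \<open>The monomials are 1 and \<open>a * b\<close>, indexed by 0 and 1: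
    \<open>of_nat i\<close> selects the second and \<open>1 - of_nat i\<close> the first. In the
    later instances \<open>1 - 2 * of_nat i\<close> is the difference of the two, with coefficient
    sum 2.\<close>
  using weil_height_quotient_le[OF assms assms(1), of "{..1 :: nat}" "\<lambda>i. i" 1 "\<lambda>i. i" 1 "\<lambda>_. 0" 0
      "\<lambda>i. of_nat i" 1 "\<lambda>i. 1 - of_nat i"] by simp

lemma weil_height_inverse_le:
  assumes "algebraic a" "a \<noteq> 0"
  shows "weil_height (inverse a) \<le> weil_height a"
  using weil_height_quotient_le[OF assms(1,1,1), of "{..1 :: nat}" "\<lambda>i. i" 1 "\<lambda>_. 0" 0 "\<lambda>_. 0" 0
      "\<lambda>i. 1 - of_nat i" 1 "\<lambda>i. of_nat i"] assms(2) by (simp add: divide_inverse)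

lemma weil_height_inverse:
  assumes "algebraic a" "a \<noteq> 0"
  shows "weil_height (inverse a) = weil_height a"
  using weil_height_inverse_le[of a] weil_height_inverse_le[of "inverse a"] assms
  by (auto simp: algebraic_inverse intro: antisym)

lemma weil_height_divide_le_add:
  assumes "algebraic a" "algebraic b" "b \<noteq> 0"
  shows "weil_height (a / b) \<le> weil_height a + weil_height b"
  using weil_height_mult_le[of a "inverse b"] assms
  by (simp add: divide_inverse algebraic_inverse weil_height_inverse)

lemma weil_height_1: "weil_height 1 = 0"
proof (rule antisym)
  show "weil_height 1 \<le> 0"
    using weil_height_quotient_le[of 1 1 1 "{0 :: nat}" "\<lambda>_. 0" 0 "\<lambda>_. 0" 0 "\<lambda>_. 0" 0 "\<lambda>_. 1" 1 "\<lambda>_. 1"]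
    by simp
qed (simp add: weil_height_nonneg)

lemma weil_height_power_le:
  "algebraic a \<Longrightarrow> weil_height (a ^ n) \<le> real n * weil_height a"
proof (induction n)
  case (Suc n)
  then show ?case using weil_height_mult_le[of a "a ^ n"]
    by (simp add: algebraic_power algebra_simps)
qed (simp add: weil_height_1)

lemma weil_height_one_minus_le:
  assumes "algebraic x"
  shows "weil_height (1 - x) \<le> weil_height x + ln 2"
  using weil_height_quotient_le[OF assms assms assms, of "{..1 :: nat}" "\<lambda>i. i" 1 "\<lambda>_. 0" 0 "\<lambda>_. 0" 0
      "\<lambda>i. 1 - 2 * of_nat i" 2 "\<lambda>i. 1 - of_nat i"] by simp

text \<open>Combining the bounds for quotients and for \<open>1 - x\<close> would cost twice the
  height of \<open>x\<close>; the projective form costs it once, which the lower bound for solutions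
  of the unit equation relies on.\<close>

lemma weil_height_odds_le:
  assumes "algebraic x" "x \<noteq> 1"
  shows "weil_height (x / (1 - x)) \<le> weil_height x + ln 2"
  using weil_height_quotient_le[OF assms(1,1,1), of "{..1 :: nat}" "\<lambda>i. i" 1 "\<lambda>_. 0" 0 "\<lambda>_. 0" 0
      "\<lambda>i. of_nat i" 2 "\<lambda>i. 1 - 2 * of_nat i"] assms(2) by simp

section \<open>Hermite--Pade approximation of powers\<close>

text \<open>A finite difference of order \<open>n\<close> kills polynomials of degree below
  \<open>n\<close>. By Pascal's rule each induction step replaces \<open>p\<close> by
  \<open>p(X) - p(X + 1)\<close>, which lowers the degree.\<close>

lemma alternating_binomial_sum_poly_eq_0:
  fixes p :: "real poly"
  assumes "degree p < n"
  shows "(\<Sum>j\<le>n. (-1) ^ j * real (n choose j) * poly p (real j)) = 0"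
  using assms
proof (induction n arbitrary: p)
  case (Suc n)
  define p' where "p' = p - pcompose p [:1, 1:]"
  have "(\<Sum>j\<le>Suc n. (-1) ^ j * real (Suc n choose j) * poly p (real j))
    = (\<Sum>j\<le>n. (-1) ^ j * real (n choose j) * poly p' (real j))"
  proof -
    have "(\<Sum>j\<le>Suc n. (-1) ^ j * real (Suc n choose j) * poly p (real j))
      = poly p 0 + (\<Sum>j\<le>n. (-1) ^ Suc j * real (Suc n choose Suc j) * poly p (real (Suc j)))"
      by (subst sum.atMost_Suc_shift) simp
    also have "(\<Sum>j\<le>n. (-1) ^ Suc j * real (Suc n choose Suc j) * poly p (real (Suc j)))
      = (\<Sum>j\<le>n. (-1) ^ Suc j * real (n choose j) * poly p (real (Suc j)))
        + (\<Sum>j\<le>n. (-1) ^ Suc j * real (n choose Suc j) * poly p (real (Suc j)))"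
      by (simp add: sum.distrib[symmetric] algebra_simps)
    also have "poly p 0 + (\<dots>) = (\<Sum>j\<le>n. (-1) ^ Suc j * real (n choose j) * poly p (real (Suc j)))
        + (\<Sum>j\<le>Suc n. (-1) ^ j * real (n choose j) * poly p (real j))"
      using sum.atMost_Suc_shift[of "\<lambda>j. (-1) ^ j * real (n choose j) * poly p (real j)" n] by simp
    also have "(\<Sum>j\<le>Suc n. (-1) ^ j * real (n choose j) * poly p (real j))
       = (\<Sum>j\<le>n. (-1) ^ j * real (n choose j) * poly p (real j))" by simp
    finally show ?thesis
      by (simp add: p'_def poly_pcompose sum.distrib[symmetric] algebra_simps)
  qed
  also have "\<dots> = 0"
  proof (cases "degree p = 0")
    case True
    then obtain c where "p = [:c:]" by (rule degree_eq_zeroE)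
    then have "p' = 0" by (simp add: p'_def)
    then show ?thesis by simp
  next
    case False
    have "degree (pcompose p [:1, 1:]) = degree p" by simp
    moreover from this have "coeff (pcompose p [:1, 1:]) (degree p) = lead_coeff p"
      using lead_coeff_comp[of "[:1, 1:]" p] by simp
    ultimately have "degree p' \<le> degree p" "coeff p' (degree p) = 0"
      by (auto simp: p'_def degree_diff_le)
    then have "degree p' < degree p"
      using False by (metis degree_0 le_neq_implies_less leading_coeff_0_iff not_gr_zero)
    then show ?thesis using Suc by simp
  qed
  finally show ?case .
qed auto

lemma fact_diff_eq_prod:
  assumes "m \<le> n" "j \<le> m"
  shows "(fact (n - j) :: real) = fact (m - j) * (\<Prod>i=Suc m..n. real i - real j)"
  using assms(1)
proof (induction n rule: dec_induct)
  case (step n)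
  then show ?case using assms(2) by (simp add: Suc_diff_le of_nat_diff algebra_simps)
qed auto

lemma fact_add_eq_prod:
  assumes "m \<le> n"
  shows "(fact (n + j) :: real) = fact (m + j) * (\<Prod>i=Suc m..n. real i + real j)"
  using assms
  by (induction n rule: dec_induct) (simp_all add: algebra_simps)

text \<open>Up to the sign and a constant factor, the summand is a binomial coefficient \<open>n choose j\<close>
  times a polynomial in \<open>j\<close> of degree \<open>n - 1\<close>.\<close>

lemma pade_coefficient_sum_eq_0:
  assumes k: "n < k" "k \<le> 2 * n"
  shows "(\<Sum>j\<le>n. (-1) ^ j * real ((2 * n + 1 choose (k - j)) * (n + j choose n) * (2 * n - j choose n))) = 0"
proof -
  \<comment> \<open>The two products are \<open>(2 n - j)! / (k - j)!\<close> and
    \<open>(n + j)! / (2 n + 1 - k + j)!\<close> as polynomials in \<open>j\<close>, of degrees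
    \<open>2 n - k\<close> and \<open>k - n - 1\<close>.\<close>
  define T :: "real poly" where
    "T = (\<Prod>i=Suc k..2 * n. [:real i, -1:]) * (\<Prod>i=Suc (2 * n + 1 - k)..n. [:real i, 1:])"
  have "degree T = (2 * n - k) + (n - (2 * n + 1 - k))"
    unfolding T_def by (subst degree_mult_eq) (auto simp: degree_prod_sum_eq)
  then have deg: "degree T < n" using k by linarith
  define c :: real where "c = fact (2 * n + 1) / fact n ^ 3"
  have "real ((2 * n + 1 choose (k - j)) * (n + j choose n) * (2 * n - j choose n))
      = c * (real (n choose j) * poly T (real j))" if j: "j \<le> n" for j
  proof -
    have e: "2 * n + 1 - (k - j) = (2 * n + 1 - k) + j" "2 * n - j - n = n - j"
      using k j by auto
    have f1: "(fact (2 * n - j) :: real) = fact (k - j) * (\<Prod>i=Suc k..2 * n. real i - real j)"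
      using k j by (intro fact_diff_eq_prod) auto
    have f2: "(fact (n + j) :: real) = fact (2 * n + 1 - k + j) * (\<Prod>i=Suc (2 * n + 1 - k)..n. real i + real j)"
      using k by (intro fact_add_eq_prod) auto
    have b1: "real (2 * n + 1 choose (k - j)) = fact (2 * n + 1) / (fact (k - j) * fact (2 * n + 1 - k + j))"
      using k j by (subst binomial_fact) (auto simp: e)
    have b2: "real (n + j choose n) = fact (n + j) / (fact n * fact j)"
      by (subst binomial_fact) auto
    have b3: "real (2 * n - j choose n) = fact (2 * n - j) / (fact n * fact (n - j))"
      using j by (subst binomial_fact) (auto simp: e)
    have b4: "real (n choose j) = fact n / (fact j * fact (n - j))"
      using j by (subst binomial_fact) auto
    have T: "poly T (real j) = (\<Prod>i=Suc k..2 * n. real i - real j) * (\<Prod>i=Suc (2 * n + 1 - k)..n. real i + real j)"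
      by (simp add: T_def poly_prod)
    show ?thesis
      unfolding of_nat_mult b1 b2 b3 b4 T f1 f2 c_def
      by (simp add: field_simps power3_eq_cube)
  qed
  then have "(\<Sum>j\<le>n. (-1) ^ j * real ((2 * n + 1 choose (k - j)) * (n + j choose n) * (2 * n - j choose n)))
    = (\<Sum>j\<le>n. c * ((-1) ^ j * real (n choose j) * poly T (real j)))"
    by (intro sum.cong) (simp_all add: mult_ac)
  also have "\<dots> = 0"
    by (simp only: sum_distrib_left[symmetric] alternating_binomial_sum_poly_eq_0[OF deg])
  finally show ?thesis .
qed

section \<open>The Pade triple with its degrees and coefficient bounds\<close>

definition pade_Q :: "nat \<Rightarrow> int poly" where
  "pade_Q n = (\<Sum>j\<le>n. monom (int ((n + j choose n) * (2 * n - j choose n))) j)"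

text \<open>The coefficients of \<open>pade_Q n\<close> are chosen so that this product has no terms
  of degree \<open>n + 1\<close> to \<open>2 n\<close>. The part below the gap is
  \<open>pade_R n\<close>, and the part above it yields \<open>pade_P n\<close>; so
  \<open>R / Q\<close> is the diagonal Pade approximant of \<open>(1 - X) ^ (2 n + 1)\<close> at
  0.\<close>

definition pade_W :: "nat \<Rightarrow> int poly" where
  "pade_W n = [:1, -1:] ^ (2 * n + 1) * pade_Q n"

definition pade_R :: "nat \<Rightarrow> int poly" where
  "pade_R n = poly_cutoff (Suc n) (pade_W n)"

definition pade_P :: "nat \<Rightarrow> int poly" where
  "pade_P n = - poly_shift (2 * n + 1) (pade_W n)"

lemma coeff_pade_Q:
  "coeff (pade_Q n) j = (if j \<le> n then int ((n + j choose n) * (2 * n - j choose n)) else 0)"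
  by (auto simp: pade_Q_def coeff_sum coeff_monom sum.delta)

lemma coeff_pade_W:
  "coeff (pade_W n) k = (\<Sum>j\<le>min k n. (if k - j \<le> 2 * n + 1 then
     (-1) ^ (k - j) * int ((2 * n + 1 choose (k - j)) * (n + j choose n) * (2 * n - j choose n)) else 0))"
proof -
  have lin: "coeff ([:1, -1:] ^ (2 * n + 1) :: int poly) i =
    (if i \<le> 2 * n + 1 then (-1) ^ i * int (2 * n + 1 choose i) else 0)" for i
  proof (cases "i \<le> 2 * n + 1")
    case True
    then show ?thesis by (subst coeff_linear_poly_power) auto
  next
    case False
    have "degree ([:1, -1:] ^ (2 * n + 1) :: int poly) = 2 * n + 1"
      by (subst degree_power_eq) auto
    with False show ?thesis by (simp add: coeff_eq_0 del: power_Suc)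
  qed
  have "coeff (pade_W n) k = (\<Sum>j\<le>k. coeff (pade_Q n) j * coeff ([:1, -1:] ^ (2 * n + 1)) (k - j))"
    unfolding pade_W_def by (subst mult.commute) (rule coeff_mult)
  also have "\<dots> = (\<Sum>j\<le>min k n. coeff (pade_Q n) j * coeff ([:1, -1:] ^ (2 * n + 1)) (k - j))"
    by (intro sum.mono_neutral_right) (auto simp: coeff_pade_Q)
  also have "\<dots> = (\<Sum>j\<le>min k n. (if k - j \<le> 2 * n + 1 then
     (-1) ^ (k - j) * int ((2 * n + 1 choose (k - j)) * (n + j choose n) * (2 * n - j choose n)) else 0))"
    unfolding lin by (intro sum.cong) (auto simp: coeff_pade_Q)
  finally show ?thesis .
qed

lemma coeff_pade_W_eq_0:
  assumes "n < k" "k \<le> 2 * n"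
  shows "coeff (pade_W n) k = 0"
proof -
  have "real_of_int (coeff (pade_W n) k) = (\<Sum>j\<le>n. (-1) ^ (k - j) *
      real ((2 * n + 1 choose (k - j)) * (n + j choose n) * (2 * n - j choose n)))"
    unfolding coeff_pade_W using assms by (auto simp: min_def intro!: sum.cong)
  also have "\<dots> = (\<Sum>j\<le>n. (-1) ^ k * ((-1) ^ j *
      real ((2 * n + 1 choose (k - j)) * (n + j choose n) * (2 * n - j choose n))))"
  proof (rule sum.cong, goal_cases)
    case (2 j)
    then have "even (k - j) \<longleftrightarrow> even (k + j)" using assms by (auto simp: even_diff_nat)
    then have "(-1 :: real) ^ (k - j) = (-1) ^ k * (-1) ^ j"
      by (simp add: minus_one_power_iff flip: power_add)
    then show ?case by simp
  qed auto
  also have "\<dots> = 0"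
    by (simp only: sum_distrib_left[symmetric] pade_coefficient_sum_eq_0[OF assms])
  finally show ?thesis by simp
qed

lemma degree_pade_W: "degree (pade_W n) \<le> 3 * n + 1"
proof -
  have "degree (pade_Q n) \<le> n" by (rule degree_le) (auto simp: coeff_pade_Q)
  moreover have "degree ([:1, -1:] ^ (2 * n + 1) :: int poly) \<le> 2 * n + 1"
    using degree_power_le[of "[:1, -1:] :: int poly" "2 * n + 1"] by simp
  ultimately show ?thesis
    unfolding pade_W_def using degree_mult_le[of "[:1, -1:] ^ (2 * n + 1)" "pade_Q n"] by linarith
qed

lemma pade_identity:
  "monom 1 (2 * n + 1) * pade_P n + [:1, -1:] ^ (2 * n + 1) * pade_Q n = pade_R n"
  unfolding pade_W_def[symmetric]
proof (rule poly_eqI)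
  fix k
  consider "k \<le> n" | "n < k" "k \<le> 2 * n" | "k > 2 * n" by linarith
  then show "coeff (monom 1 (2 * n + 1) * pade_P n + pade_W n) k = coeff (pade_R n) k"
    by cases (auto simp: coeff_monom_mult pade_P_def pade_R_def coeff_poly_shift coeff_poly_cutoff
        coeff_pade_W_eq_0 simp del: One_nat_def)
qed

lemma degree_pade:
  "degree (pade_P n) \<le> n" "degree (pade_Q n) \<le> n" "degree (pade_R n) \<le> n"
proof -
  show "degree (pade_P n) \<le> n"
    using degree_pade_W[of n]
    by (intro degree_le) (auto simp: pade_P_def coeff_poly_shift intro: coeff_eq_0)
qed (auto intro!: degree_le simp: coeff_pade_Q pade_R_def coeff_poly_cutoff)

text \<open>In the top coefficient of \<open>pade_W n\<close> only \<open>j = n\<close> contributes.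
  The resulting exact degree of \<open>pade_P n\<close> enters the nonvanishing of the
  Wronskian.\<close>

lemma coeff_pade_P_n: "coeff (pade_P n) n \<noteq> 0"
proof -
  have "coeff (pade_W n) (3 * n + 1) = (\<Sum>j\<in>{n}. (-1) ^ (3 * n + 1 - j) * int ((2 * n + 1 choose (3 * n + 1 - j)) * (n + j choose n) * (2 * n - j choose n)))"
    unfolding coeff_pade_W by (intro sum.mono_neutral_cong_right) auto
  then show ?thesis by (simp add: pade_P_def coeff_poly_shift)
qed

lemma pade_R_nonzero: "pade_R n \<noteq> 0"
proof
  assume "pade_R n = 0"
  then have "coeff (pade_R n) 0 = 0" by simp
  then show False by (simp add: pade_R_def coeff_poly_cutoff coeff_pade_W)
qed

lemma Suc_le_power_two: "Suc n \<le> 2 ^ n"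
  using less_exp[of n] by (simp add: Suc_le_eq)

text \<open>Bounding binomials by powers of 2 gives \<open>2 ^ (5 n + 1)\<close> for each summand,
  and the number of summands is at most \<open>n + 1 \<le> 2 ^ n\<close>; hence the base
  \<open>64 = 2 * 32\<close>.\<close>

lemma abs_coeff_pade_W_le: "\<bar>coeff (pade_W n) k\<bar> \<le> 2 * 64 ^ n"
proof -
  have b: "(2 * n + 1 choose (k - j)) * (n + j choose n) * (2 * n - j choose n) \<le> 2 * 32 ^ n"
    if "j \<le> n" for j
  proof -
    have "(2 * n + 1 choose (k - j)) * (n + j choose n) * (2 * n - j choose n)
      \<le> 2 ^ (2 * n + 1) * 2 ^ (n + j) * 2 ^ (2 * n - j)"
      by (intro mult_mono binomial_le_pow2) auto
    also have "\<dots> = 2 ^ (5 * n + 1)" using that by (simp flip: power_add power_Suc)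
    also have "\<dots> = 2 * 32 ^ n" by (simp add: power_mult)
    finally show ?thesis .
  qed
  have "\<bar>coeff (pade_W n) k\<bar> \<le> (\<Sum>j\<le>min k n. int (2 * 32 ^ n))"
    unfolding coeff_pade_W
  proof (rule order.trans[OF sum_abs sum_mono], goal_cases)
    case (1 j)
    then have "int ((2 * n + 1 choose (k - j)) * (n + j choose n) * (2 * n - j choose n)) \<le> int (2 * 32 ^ n)"
      using b[of j] by (intro of_nat_mono) auto
    then show ?case by (auto simp: abs_mult)
  qed
  also have "\<dots> = int (Suc (min k n) * (2 * 32 ^ n))" by (simp add: algebra_simps)
  also have "\<dots> \<le> int (2 ^ n * (2 * 32 ^ n))"
    using Suc_le_power_two[of n] by (intro of_nat_mono mult_right_mono) auto
  also have "2 ^ n * (2 * 32 ^ n) = 2 * (2 * 32 :: nat) ^ n"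
    by (simp only: power_mult_distrib mult_ac)
  finally show ?thesis by simp
qed

lemma abs_coeff_pade_le:
  "\<bar>coeff (pade_P n) k\<bar> \<le> 2 * 64 ^ n" "\<bar>coeff (pade_Q n) k\<bar> \<le> 2 * 64 ^ n"
  "\<bar>coeff (pade_R n) k\<bar> \<le> 2 * 64 ^ n"
proof -
  have "(n + k choose n) * (2 * n - k choose n) \<le> 2 * 64 ^ n" if "k \<le> n"
  proof -
    have "(n + k choose n) * (2 * n - k choose n) \<le> 2 ^ (n + k) * 2 ^ (2 * n - k)"
      by (intro mult_mono binomial_le_pow2) auto
    also have "\<dots> = 2 ^ (3 * n)" using that by (simp flip: power_add)
    also have "\<dots> = 8 ^ n" by (simp add: power_mult)
    also have "\<dots> \<le> 64 ^ n" by (intro power_mono) auto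
    finally show ?thesis by simp
  qed
  from of_nat_mono[OF this, where 'a = int] show "\<bar>coeff (pade_Q n) k\<bar> \<le> 2 * 64 ^ n"
    by (auto simp: coeff_pade_Q)
qed (use abs_coeff_pade_W_le[of n] in \<open>auto simp: pade_P_def pade_R_def coeff_poly_shift coeff_poly_cutoff\<close>)

section \<open>The Wronskian of the Pade triple\<close>

lemma coeff_mult_at_degree_bounds:
  assumes "degree p \<le> a" "degree q \<le> b"
  shows "coeff (p * q) (a + b) = coeff p a * coeff q b"
proof -
  have "coeff (p * q) (a + b) = (\<Sum>i\<le>a + b. coeff p i * coeff q (a + b - i))"
    by (rule coeff_mult)
  also have "\<dots> = (\<Sum>i\<in>{a}. coeff p i * coeff q (a + b - i))"
  proof (rule sum.mono_neutral_right)
    show "\<forall>i\<in>{..a + b} - {a}. coeff p i * coeff q (a + b - i) = 0"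
    proof
      fix i assume "i \<in> {..a + b} - {a}"
      then have "degree p < i \<or> degree q < a + b - i" using assms by auto
      then show "coeff p i * coeff q (a + b - i) = 0" by (auto simp: coeff_eq_0)
    qed
  qed auto
  finally show ?thesis by simp
qed

text \<open>The Wronskian of \<open>X ^ (2 n + 1) * P\<close> and \<open>R\<close>, divided by
  \<open>X ^ (2 n)\<close>.\<close>

definition pade_wronskian :: "complex poly \<Rightarrow> complex poly \<Rightarrow> nat \<Rightarrow> complex poly" where
  "pade_wronskian P R n = [:0, 1:] * (P * pderiv R - pderiv P * R) - smult (of_nat (2 * n + 1)) (P * R)"

text \<open>With \<open>d = degree R\<close>, the coefficient of degree \<open>n + d\<close> is
  \<open>d - (3 n + 1)\<close> times the two leading coefficients, and
  \<open>d \<le> n\<close>.\<close>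

lemma pade_wronskian_nonzero:
  assumes P: "degree P = n" "P \<noteq> 0" and R: "degree R \<le> n" "R \<noteq> 0"
  shows "pade_wronskian P R n \<noteq> 0"
proof
  define d where "d = degree R"
  have "d \<le> n" using R by (simp add: d_def)
  assume "pade_wronskian P R n = 0"
  then have "0 = coeff (pade_wronskian P R n) (n + d)" by simp
  also have "pade_wronskian P R n = P * ([:0, 1:] * pderiv R) - ([:0, 1:] * pderiv P) * R - smult (of_nat (2 * n + 1)) (P * R)"
    by (simp add: pade_wronskian_def algebra_simps)
  also have "coeff \<dots> (n + d) = lead_coeff P * (of_nat d * lead_coeff R) - (of_nat n * lead_coeff P) * lead_coeff R
      - of_nat (2 * n + 1) * (lead_coeff P * lead_coeff R)"
  proof -
    have c: "degree ([:0, 1:] * pderiv S) \<le> degree S"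
      "coeff ([:0, 1:] * pderiv S) (degree S) = of_nat (degree S) * lead_coeff S" for S :: "complex poly"
    proof -
      have co: "coeff ([:0, 1:] * pderiv S) i = of_nat i * coeff S i" for i
        by (cases i) (auto simp: coeff_pderiv)
      show "coeff ([:0, 1:] * pderiv S) (degree S) = of_nat (degree S) * lead_coeff S" by (rule co)
      show "degree ([:0, 1:] * pderiv S) \<le> degree S"
        by (rule degree_le) (simp only: co, simp add: coeff_eq_0)
    qed
    have "coeff (P * ([:0, 1:] * pderiv R)) (n + d) = lead_coeff P * (of_nat d * lead_coeff R)"
      using c[of R] P by (subst coeff_mult_at_degree_bounds) (simp_all only: d_def order.refl)
    moreover have "coeff (([:0, 1:] * pderiv P) * R) (n + d) = (of_nat n * lead_coeff P) * lead_coeff R"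
      using c[of P] P by (subst coeff_mult_at_degree_bounds) (simp_all only: d_def order.refl)
    moreover have "coeff (P * R) (n + d) = lead_coeff P * lead_coeff R"
      using P by (subst coeff_mult_at_degree_bounds) (simp_all only: d_def order.refl)
    ultimately show ?thesis by (simp only: coeff_diff coeff_smult)
  qed
  also have "\<dots> = (of_nat d - of_nat (3 * n + 1)) * (lead_coeff P * lead_coeff R)"
    by (simp add: algebra_simps)
  finally have "(of_nat d :: complex) = of_nat (3 * n + 1)" using P R by auto
  then have "d = 3 * n + 1" by (simp only: of_nat_eq_iff)
  with \<open>d \<le> n\<close> show False by simp
qed

text \<open>With \<open>y = 1 - x\<close>, the Wronskian of \<open>x\<^sup>2\<^sup>n\<^sup>+\<^sup>1 P\<close> and \<open>R\<close> is also that of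
  \<open>- y\<^sup>2\<^sup>n\<^sup>+\<^sup>1 Q\<close> and \<open>R\<close>, so it vanishes to the order \<open>2 n\<close> at both 0 and 1.\<close>

lemma pade_wronskian_root:
  fixes P Q R :: "complex poly"
  assumes id: "[:0, 1:] ^ (2 * n + 1) * P + [:1, -1:] ^ (2 * n + 1) * Q = R"
    and P: "degree P = n" "P \<noteq> 0" and R: "degree R \<le> n" "R \<noteq> 0"
    and x: "poly (pade_wronskian P R n) x = 0"
  shows "x = 1"
proof -
  let ?X = "[:0, 1:] :: complex poly" and ?Y = "[:1, -1:] :: complex poly"
  let ?F = "pade_wronskian P R n"
  define m where "m = 2 * n"
  define c :: complex where "c = of_nat (2 * n + 1)"
  define G where "G = ?Y * (pderiv Q * R - Q * pderiv R) - smult c (Q * R)"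
  have dX: "pderiv (?X ^ (m + 1)) = smult c (?X ^ m)"
    unfolding pderiv_power by (simp add: c_def m_def pderiv_pCons)
  have dY: "pderiv (?Y ^ (m + 1)) = - smult c (?Y ^ m)"
    unfolding pderiv_power by (simp add: c_def m_def pderiv_pCons)
  define U where "U = ?X ^ (m + 1) * P"
  have RU: "R = U + ?Y ^ (m + 1) * Q" using id by (simp only: U_def m_def)
  have dU: "pderiv U = smult c (?X ^ m) * P + ?X ^ (m + 1) * pderiv P"
    unfolding U_def pderiv_mult dX by (simp add: algebra_simps)
  have dR: "pderiv R = pderiv U + (- smult c (?Y ^ m) * Q + ?Y ^ (m + 1) * pderiv Q)"
    using arg_cong[OF RU, of pderiv] unfolding pderiv_add pderiv_mult dY by (simp add: algebra_simps)
  have "?X ^ m * ?F = U * pderiv R - pderiv U * R"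
    unfolding dU by (simp add: pade_wronskian_def U_def m_def c_def algebra_simps)
  also have "\<dots> = (R - ?Y ^ (m + 1) * Q) * pderiv R
      - (pderiv R - (- smult c (?Y ^ m) * Q + ?Y ^ (m + 1) * pderiv Q)) * R"
    by (subst (1) RU, subst (2) dR) (simp add: algebra_simps)
  also have "\<dots> = ?Y ^ m * G"
    by (simp add: G_def algebra_simps)
  finally have eq: "?X ^ m * ?F = ?Y ^ m * G" .
  have "Rings.coprime ?Y ?X"
  proof (rule Rings.coprimeI)
    fix d assume "d dvd ?Y" "d dvd ?X"
    then have "d dvd ?Y + ?X" by (rule dvd_add)
    moreover have "?Y + ?X = 1"
      by (rule poly_eqI) (auto simp: coeff_pCons split: nat.splits)
    ultimately show "is_unit d" by (simp only:)
  qed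
  then have "Rings.coprime (?Y ^ m) (?X ^ m)" by (cases "m = 0") auto
  moreover have "?Y ^ m dvd ?X ^ m * ?F" unfolding eq by simp
  ultimately have "?Y ^ m dvd ?F" by (simp add: coprime_dvd_mult_right_iff)
  then obtain H where H: "?F = ?Y ^ m * H" by auto
  have "?F \<noteq> 0" using P R by (rule pade_wronskian_nonzero)
  then have "H \<noteq> 0" using H by auto
  have degY: "degree (?Y ^ m) = m" by (subst degree_power_eq) auto
  \<comment> \<open>This bound leaves only a constant besides the factor
    \<open>(1 - X) ^ (2 n)\<close> already split off.\<close>
  have "degree ?F \<le> 2 * n"
  proof -
    have d1: "degree ([:0, 1:] * pderiv S) \<le> degree S" for S :: "complex poly"
    proof (rule degree_le, intro allI impI)
      fix i assume "degree S < i"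
      then show "coeff ([:0, 1:] * pderiv S) i = 0" by (cases i) (auto simp: coeff_pderiv coeff_eq_0)
    qed
    have "?F = P * (?X * pderiv R) - (?X * pderiv P) * R - smult (of_nat (2 * n + 1)) (P * R)"
      by (simp add: pade_wronskian_def algebra_simps)
    also have "degree \<dots> \<le> 2 * n"
      using P R d1[of P] d1[of R]
      by (intro degree_diff_le order.trans[OF degree_mult_le] order.trans[OF degree_smult_le]) auto
    finally show ?thesis .
  qed
  moreover have "degree ?F = m + degree H"
    unfolding H using \<open>H \<noteq> 0\<close> by (subst degree_mult_eq) (auto simp: degY)
  ultimately have "degree H = 0" by (simp add: m_def)
  then obtain h where h: "H = [:h:]" by (rule degree_eq_zeroE)
  with \<open>H \<noteq> 0\<close> have "h \<noteq> 0" by auto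
  have "(1 - x) ^ m = 0" using x \<open>h \<noteq> 0\<close> unfolding H h by (auto simp: poly_power)
  then show "x = 1" by simp
qed

section \<open>A second triple obtained by differentiation\<close>

definition pade_P' :: "nat \<Rightarrow> int poly" where
  "pade_P' n = [:1, -1:] * (smult (int (2 * n + 1)) (pade_P n) + [:0, 1:] * pderiv (pade_P n))"

definition pade_Q' :: "nat \<Rightarrow> int poly" where
  "pade_Q' n = [:0, 1:] * ([:1, -1:] * pderiv (pade_Q n) - smult (int (2 * n + 1)) (pade_Q n))"

definition pade_R' :: "nat \<Rightarrow> int poly" where
  "pade_R' n = [:0, 1:] * ([:1, -1:] * pderiv (pade_R n))"

text \<open>This is \<open>pade_identity\<close> differentiated and multiplied by
  \<open>X (1 - X)\<close>, which restores the powers \<open>2 n + 1\<close> and raises the degrees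
  by one.\<close>

lemma pade'_identity:
  "monom 1 (2 * n + 1) * pade_P' n + [:1, -1:] ^ (2 * n + 1) * pade_Q' n = pade_R' n"
proof -
  let ?X = "[:0, 1:] :: int poly" and ?Y = "[:1, -1:] :: int poly"
  define c where "c = int (2 * n + 1)"
  define m where "m = 2 * n"
  have X: "monom 1 (2 * n + 1) = ?X ^ (m + 1)" by (simp add: monom_altdef m_def)
  have dX: "pderiv (?X ^ (m + 1)) = smult c (?X ^ m)"
    unfolding pderiv_power by (simp add: c_def m_def pderiv_pCons)
  have dY: "pderiv (?Y ^ (m + 1)) = - smult c (?Y ^ m)"
    unfolding pderiv_power by (simp add: c_def m_def pderiv_pCons)
  have "?X ^ (m + 1) * pade_P n + ?Y ^ (m + 1) * pade_Q n = pade_R n"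
    using pade_identity[of n] by (simp only: X) (simp only: m_def)
  then have "pderiv (pade_R n) = pderiv (?X ^ (m + 1) * pade_P n + ?Y ^ (m + 1) * pade_Q n)" by simp
  then have dR: "pderiv (pade_R n) = smult c (?X ^ m) * pade_P n + ?X ^ (m + 1) * pderiv (pade_P n)
      - smult c (?Y ^ m) * pade_Q n + ?Y ^ (m + 1) * pderiv (pade_Q n)"
    unfolding pderiv_add pderiv_mult dX dY by (simp add: algebra_simps)
  have "pade_R' n = ?X * (?Y * (smult c (?X ^ m) * pade_P n + ?X ^ (m + 1) * pderiv (pade_P n)
      - smult c (?Y ^ m) * pade_Q n + ?Y ^ (m + 1) * pderiv (pade_Q n)))"
    unfolding pade_R'_def dR ..
  also have "\<dots> = ?X ^ (m + 1) * pade_P' n + ?Y ^ (m + 1) * pade_Q' n"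
    unfolding pade_P'_def pade_Q'_def c_def[symmetric]
    by (simp add: algebra_simps del: mult_pCons_left mult_pCons_right)
  finally show ?thesis unfolding X by (simp add: m_def)
qed

lemma coeff_X_mult: "coeff ([:0, 1:] * p) i = (if i = 0 then 0 else coeff p (i - 1))"
  for p :: "'a :: comm_ring_1 poly"
  by (cases i) auto

lemma coeff_one_minus_X_mult:
  "coeff ([:1, -1:] * p) i = coeff p i - (if i = 0 then 0 else coeff p (i - 1))"
  for p :: "'a :: comm_ring_1 poly"
  by (cases i) auto

text \<open>The new coefficients are at most \<open>8 n + 4\<close> times the bound
  \<open>2 * 64 ^ n\<close>, and \<open>8 n + 4 \<le> 8 * 2 ^ n\<close>.\<close>

lemma abs_coeff_pade'_le:
  assumes "k \<le> n + 1"
  shows "\<bar>coeff (pade_P' n) k\<bar> \<le> 16 * 128 ^ n" "\<bar>coeff (pade_Q' n) k\<bar> \<le> 16 * 128 ^ n"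
    "\<bar>coeff (pade_R' n) k\<bar> \<le> 16 * 128 ^ n"
proof -
  define M :: int where "M = 2 * 64 ^ n"
  have M: "\<bar>coeff (pade_P n) i\<bar> \<le> M" "\<bar>coeff (pade_Q n) i\<bar> \<le> M" "\<bar>coeff (pade_R n) i\<bar> \<le> M" for i
    using abs_coeff_pade_le[of n i] by (auto simp: M_def)
  have z: "coeff (pade_P n) i = 0" "coeff (pade_Q n) i = 0" "coeff (pade_R n) i = 0" if "i > n" for i
    using degree_pade[of n] that by (auto intro: coeff_eq_0)
  have "M \<ge> 0" by (simp add: M_def)
  have bound: "\<bar>c * a\<bar> \<le> d * M" if "\<bar>c\<bar> \<le> d" "\<bar>a\<bar> \<le> M" for a c d :: int
    using that by (simp add: abs_mult mult_mono)
  have fin: "(8 * int n + 4) * M \<le> 16 * 128 ^ n"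
  proof -
    have "8 * int n + 4 \<le> 8 * int (Suc n)" by simp
    also have "\<dots> \<le> 8 * int (2 ^ n)" using Suc_le_power_two[of n] by (intro mult_left_mono of_nat_mono) auto
    finally have "(8 * int n + 4) * M \<le> 8 * int (2 ^ n) * M" using \<open>M \<ge> 0\<close> by (rule mult_right_mono)
    also have "\<dots> = 16 * (2 * 64) ^ n" unfolding M_def by (simp only: power_mult_distrib) simp
    finally show ?thesis by simp
  qed
  have p1: "\<bar>coeff (smult (int (2 * n + 1)) (pade_P n) + [:0, 1:] * pderiv (pade_P n)) i\<bar> \<le> (4 * int n + 2) * M" for i
  proof (cases "i \<le> n")
    case True
    have "coeff (smult (int (2 * n + 1)) (pade_P n) + [:0, 1:] * pderiv (pade_P n)) i
      = (int (2 * n + 1) + int i) * coeff (pade_P n) i"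
      by (cases i) (simp_all add: coeff_pderiv algebra_simps)
    then show ?thesis using True by (simp only:) (rule bound, auto simp: M)
  next
    case False
    then show ?thesis using \<open>M \<ge> 0\<close> by (cases i) (auto simp: coeff_pderiv z)
  qed
  have "\<bar>coeff (pade_P' n) k\<bar> \<le> (4 * int n + 2) * M + (4 * int n + 2) * M"
    unfolding pade_P'_def coeff_one_minus_X_mult using p1[of k] p1[of "k - 1"]
    by (intro order.trans[OF abs_triangle_ineq4] add_mono) (auto simp: \<open>M \<ge> 0\<close>)
  also have "\<dots> = (8 * int n + 4) * M" by (simp add: algebra_simps)
  finally show "\<bar>coeff (pade_P' n) k\<bar> \<le> 16 * 128 ^ n" using fin by linarith
  have dbound: "\<bar>coeff (pderiv p) i\<bar> \<le> (int n + 1) * M" if "\<And>i. \<bar>coeff p i\<bar> \<le> M" "\<And>i. i > n \<Longrightarrow> coeff p i = 0"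
    for p i
  proof (cases "i \<le> n")
    case True
    then show ?thesis unfolding coeff_pderiv using that(1)[of "Suc i"] by (intro bound) auto
  next
    case False
    then show ?thesis using that(2)[of "Suc i"] \<open>M \<ge> 0\<close> by (simp add: coeff_pderiv)
  qed
  have ybound: "\<bar>coeff ([:1, -1:] * pderiv p) i\<bar> \<le> (2 * int n + 2) * M"
    if "\<And>i. \<bar>coeff p i\<bar> \<le> M" "\<And>i. i > n \<Longrightarrow> coeff p i = 0" for p i
  proof -
    have "\<bar>coeff ([:1, -1:] * pderiv p) i\<bar> \<le> (int n + 1) * M + (int n + 1) * M"
      unfolding coeff_one_minus_X_mult
      using dbound[of p i, OF that] dbound[of p "i - 1", OF that] \<open>M \<ge> 0\<close>
      by (intro order.trans[OF abs_triangle_ineq4] add_mono) auto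
    then show ?thesis by (simp add: algebra_simps)
  qed
  have q1: "\<bar>coeff ([:1, -1:] * pderiv (pade_Q n) - smult (int (2 * n + 1)) (pade_Q n)) i\<bar> \<le> (8 * int n + 4) * M" for i
  proof -
    have "\<bar>coeff ([:1, -1:] * pderiv (pade_Q n)) i\<bar> \<le> (2 * int n + 2) * M" using M z by (intro ybound)
    moreover have "\<bar>int (2 * n + 1) * coeff (pade_Q n) i\<bar> \<le> int (2 * n + 1) * M" using M by (intro bound) auto
    ultimately have "\<bar>coeff ([:1, -1:] * pderiv (pade_Q n) - smult (int (2 * n + 1)) (pade_Q n)) i\<bar>
      \<le> (2 * int n + 2) * M + int (2 * n + 1) * M"
      unfolding coeff_diff coeff_smult by (intro order.trans[OF abs_triangle_ineq4] add_mono)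
    also have "\<dots> = (4 * int n + 3) * M" by (simp add: algebra_simps)
    also have "\<dots> \<le> (8 * int n + 4) * M" using \<open>M \<ge> 0\<close> by (intro mult_right_mono) auto
    finally show ?thesis .
  qed
  show "\<bar>coeff (pade_Q' n) k\<bar> \<le> 16 * 128 ^ n"
    unfolding pade_Q'_def coeff_X_mult using q1[of "k - 1"] fin by auto
  have "\<bar>coeff ([:1, -1:] * pderiv (pade_R n)) i\<bar> \<le> (8 * int n + 4) * M" for i
  proof -
    have "\<bar>coeff ([:1, -1:] * pderiv (pade_R n)) i\<bar> \<le> (2 * int n + 2) * M" using M z by (intro ybound)
    also have "\<dots> \<le> (8 * int n + 4) * M" using \<open>M \<ge> 0\<close> by (intro mult_right_mono) auto
    finally show ?thesis .
  qed
  from this[of "k - 1"] show "\<bar>coeff (pade_R' n) k\<bar> \<le> 16 * 128 ^ n"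
    unfolding pade_R'_def coeff_X_mult using fin by auto
qed

lemma degree_pade':
  "degree (pade_P' n) \<le> n + 1" "degree (pade_Q' n) \<le> n + 1" "degree (pade_R' n) \<le> n + 1"
proof -
  have z: "coeff (pade_P n) i = 0" "coeff (pade_Q n) i = 0" "coeff (pade_R n) i = 0" if "i > n" for i
    using degree_pade[of n] that by (auto intro: coeff_eq_0)
  show "degree (pade_P' n) \<le> n + 1"
    by (rule degree_le) (simp only: pade_P'_def coeff_one_minus_X_mult coeff_X_mult coeff_add coeff_smult coeff_pderiv, simp add: z)
  show "degree (pade_Q' n) \<le> n + 1"
    by (rule degree_le) (simp only: pade_Q'_def coeff_one_minus_X_mult coeff_X_mult coeff_diff coeff_smult coeff_pderiv, simp add: z)
  show "degree (pade_R' n) \<le> n + 1"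
    by (rule degree_le) (simp only: pade_R'_def coeff_one_minus_X_mult coeff_X_mult coeff_pderiv, simp add: z)
qed

abbreviation ipoly :: "int poly \<Rightarrow> complex \<Rightarrow> complex" where
  "ipoly p x \<equiv> poly (map_poly of_int p) x"

lemma ipoly_pade_identity:
  assumes "monom 1 m * P + [:1, -1:] ^ m * Q = R"
  shows "x ^ m * ipoly P x + (1 - x) ^ m * ipoly Q x = ipoly R x"
proof -
  have "ipoly (monom 1 m * P + [:1, -1:] ^ m * Q) x = x ^ m * ipoly P x + (1 - x) ^ m * ipoly Q x"
    by (simp add: of_int_poly_hom.hom_add of_int_poly_hom.hom_mult of_int_poly_hom.hom_power poly_monom
        of_int_hom.map_poly_pCons_hom of_int_hom.map_poly_hom_monom)
  then show ?thesis using assms by simp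
qed

text \<open>If both triples were proportional at \<open>x\<close> to the given relation, they would
  be proportional to each other, and the Wronskian would vanish at some \<open>x \<noteq> 1\<close>.
  So at least one of the two triples gives an independent relation.\<close>

lemma pade_independent:
  fixes x A B :: complex
  assumes x: "x \<noteq> 1" and AB: "A * x ^ (2 * n + 1) + B * (1 - x) ^ (2 * n + 1) = 1"
  obtains P Q R :: "int poly" where
    "degree P \<le> n + 1" "degree Q \<le> n + 1" "degree R \<le> n + 1"
    "\<And>k. k \<le> n + 1 \<Longrightarrow> \<bar>coeff P k\<bar> \<le> 16 * 128 ^ n" "\<And>k. k \<le> n + 1 \<Longrightarrow> \<bar>coeff Q k\<bar> \<le> 16 * 128 ^ n"
    "\<And>k. k \<le> n + 1 \<Longrightarrow> \<bar>coeff R k\<bar> \<le> 16 * 128 ^ n"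
    "x ^ (2 * n + 1) * ipoly P x + (1 - x) ^ (2 * n + 1) * ipoly Q x = ipoly R x"
    "A * ipoly Q x - B * ipoly P x \<noteq> 0"
proof -
  let ?p = "map_poly of_int (pade_P n) :: complex poly" and ?q = "map_poly of_int (pade_Q n) :: complex poly"
    and ?r = "map_poly of_int (pade_R n) :: complex poly"
  define c :: complex where "c = of_nat (2 * n + 1)"
  have id: "x ^ (2 * n + 1) * ipoly (pade_P n) x + (1 - x) ^ (2 * n + 1) * ipoly (pade_Q n) x = ipoly (pade_R n) x"
    by (rule ipoly_pade_identity[OF pade_identity])
  have id': "x ^ (2 * n + 1) * ipoly (pade_P' n) x + (1 - x) ^ (2 * n + 1) * ipoly (pade_Q' n) x = ipoly (pade_R' n) x"
    by (rule ipoly_pade_identity[OF pade'_identity])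
  have "A * ipoly (pade_Q n) x - B * ipoly (pade_P n) x \<noteq> 0 \<or> A * ipoly (pade_Q' n) x - B * ipoly (pade_P' n) x \<noteq> 0"
  proof (rule ccontr)
    assume "\<not> ?thesis"
    then have dep: "A * ipoly (pade_Q n) x = B * ipoly (pade_P n) x" "A * ipoly (pade_Q' n) x = B * ipoly (pade_P' n) x"
      by auto
    \<comment> \<open>A vanishing determinant makes the relation \<open>(p, q, r)\<close> equal to
      \<open>r\<close> times \<open>(A, B, 1)\<close>.\<close>
    have AB_eq: "p = A * r" if "x ^ (2 * n + 1) * p + (1 - x) ^ (2 * n + 1) * q = r" "A * q = B * p" for p q r
    proof -
      have "p = p * (A * x ^ (2 * n + 1) + B * (1 - x) ^ (2 * n + 1))" by (simp only: AB mult_1_right)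
      also have "\<dots> = A * (x ^ (2 * n + 1) * p) + (1 - x) ^ (2 * n + 1) * (B * p)" by (simp add: algebra_simps)
      also have "\<dots> = A * r" unfolding that(2)[symmetric] that(1)[symmetric] by (simp add: algebra_simps)
      finally show ?thesis .
    qed
    have e1: "ipoly (pade_P n) x * ipoly (pade_R' n) x = ipoly (pade_P' n) x * ipoly (pade_R n) x"
      using AB_eq[OF id dep(1)] AB_eq[OF id' dep(2)] by simp
    have e2: "ipoly (pade_P' n) x = (1 - x) * (c * ipoly (pade_P n) x + x * poly (pderiv ?p) x)"
      unfolding pade_P'_def c_def
      by (simp add: of_int_poly_hom.hom_add of_int_poly_hom.hom_mult of_int_hom.map_poly_pCons_hom
          of_int_hom.map_poly_hom_smult of_int_hom.map_poly_pderiv of_int_poly_hom.hom_uminus algebra_simps)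
    have e3: "ipoly (pade_R' n) x = x * ((1 - x) * poly (pderiv ?r) x)"
      unfolding pade_R'_def
      by (simp add: of_int_poly_hom.hom_add of_int_poly_hom.hom_mult of_int_hom.map_poly_pCons_hom
          of_int_hom.map_poly_hom_smult of_int_hom.map_poly_pderiv of_int_poly_hom.hom_uminus algebra_simps)
    have e4: "poly (pade_wronskian ?p ?r n) x
        = x * (poly ?p x * poly (pderiv ?r) x - poly (pderiv ?p) x * poly ?r x) - c * (poly ?p x * poly ?r x)"
      by (simp add: pade_wronskian_def c_def)
    have "(1 - x) * poly (pade_wronskian ?p ?r n) x
        = ipoly (pade_P n) x * ipoly (pade_R' n) x - ipoly (pade_P' n) x * ipoly (pade_R n) x"
      unfolding e2 e3 e4 by (simp add: algebra_simps)
    then have "(1 - x) * poly (pade_wronskian ?p ?r n) x = 0" using e1 by simp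
    then have "poly (pade_wronskian ?p ?r n) x = 0" using x by simp
    moreover have "degree ?p = n" "?p \<noteq> 0"
      using degree_pade(1)[of n] coeff_pade_P_n[of n] by (auto intro!: antisym le_degree)
    moreover have "degree ?r \<le> n" "?r \<noteq> 0"
      using degree_pade(3)[of n] pade_R_nonzero[of n] by auto
    moreover have "[:0, 1:] ^ (2 * n + 1) * ?p + [:1, -1:] ^ (2 * n + 1) * ?q = ?r"
      unfolding pade_identity[symmetric]
      by (simp add: of_int_poly_hom.hom_add of_int_poly_hom.hom_mult of_int_poly_hom.hom_power
        of_int_hom.map_poly_pCons_hom of_int_hom.map_poly_hom_monom monom_altdef del: mult_pCons_left)
    ultimately show False using pade_wronskian_root[of n ?p ?q ?r x] x by blast
  qed
  then show ?thesis
  proof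
    assume nz: "A * ipoly (pade_Q n) x - B * ipoly (pade_P n) x \<noteq> 0"
    \<comment> \<open>The first triple satisfies the weaker bounds stated for both.\<close>
    have le: "(2 * 64 ^ n :: int) \<le> 16 * 128 ^ n" by (intro mult_mono power_mono) auto
    show ?thesis
      by (rule that[OF _ _ _ _ _ _ id nz])
         (use degree_pade[of n] in \<open>auto intro: order.trans[OF abs_coeff_pade_le(1) le]
           order.trans[OF abs_coeff_pade_le(2) le] order.trans[OF abs_coeff_pade_le(3) le]\<close>)
  next
    assume nz: "A * ipoly (pade_Q' n) x - B * ipoly (pade_P' n) x \<noteq> 0"
    show ?thesis
      by (rule that[OF degree_pade' abs_coeff_pade'_le id' nz])
  qed
qed

text \<open>Solving the two linear relations expresses \<open>x ^ (2 n + 1)\<close> as a quotient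
  linear in \<open>A\<close> and \<open>B\<close> and of degree at most \<open>n + 1\<close> in
  \<open>x\<close>. Comparing \<open>(2 n + 1) h(x)\<close> with \<open>(n + 1) h(x)\<close> leaves
  a gain of \<open>n h(x)\<close>.\<close>

lemma weil_height_unit_power_bound:
  fixes x A B :: complex
  assumes alg: "algebraic x" "algebraic A" "algebraic B" and "x \<noteq> 1"
    and AB: "A * x ^ (2 * n + 1) + B * (1 - x) ^ (2 * n + 1) = 1"
  shows "real n * weil_height x \<le> weil_height A + weil_height B + real (n + 1) * ln 256"
proof -
  obtain P Q R :: "int poly" where
    deg: "degree P \<le> n + 1" "degree Q \<le> n + 1" "degree R \<le> n + 1" and
    P: "\<And>k. k \<le> n + 1 \<Longrightarrow> \<bar>coeff P k\<bar> \<le> 16 * 128 ^ n" and Q: "\<And>k. k \<le> n + 1 \<Longrightarrow> \<bar>coeff Q k\<bar> \<le> 16 * 128 ^ n" and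
    R: "\<And>k. k \<le> n + 1 \<Longrightarrow> \<bar>coeff R k\<bar> \<le> 16 * 128 ^ n" and
    id: "x ^ (2 * n + 1) * ipoly P x + (1 - x) ^ (2 * n + 1) * ipoly Q x = ipoly R x" and
    nz: "A * ipoly Q x - B * ipoly P x \<noteq> 0"
    using pade_independent[OF assms(4) AB] by blast
  \<comment> \<open>The index \<open>(t, k)\<close> stands for \<open>x ^ k\<close> if
    \<open>t = 0\<close>, for \<open>B * x ^ k\<close> if \<open>t = 1\<close>, and for
    \<open>A * x ^ k\<close> if \<open>t = 2\<close>.\<close>
  let ?I = "{..2 :: nat} \<times> {..n + 1}"
  define F where "F = (\<lambda>(t :: nat, k). if t = 0 then coeff Q k else if t = 1 then - coeff R k else 0)"
  define G where "G = (\<lambda>(t :: nat, k). if t = 0 then 0 else if t = 1 then - coeff P k else coeff Q k)"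
  define eA where "eA = (\<lambda>(t :: nat, k :: nat). if t = 2 then 1 else 0 :: nat)"
  define eB where "eB = (\<lambda>(t :: nat, k :: nat). if t = 1 then 1 else 0 :: nat)"
  define ex where "ex = (\<lambda>(t :: nat, k :: nat). k)"
  have split: "(\<Sum>i\<in>?I. f i) = (\<Sum>k\<le>n + 1. f (0, k)) + (\<Sum>k\<le>n + 1. f (1, k)) + (\<Sum>k\<le>n + 1. f (2, k))"
    for f :: "nat \<times> nat \<Rightarrow> 'a :: comm_monoid_add"
    by (simp add: sum.cartesian_product'[symmetric] numeral_2_eq_2 add_ac del: sum.atMost_Suc)
       (simp add: sum.cartesian_product' add_ac)
  have ip: "(\<Sum>k\<le>n + 1. of_int (coeff S k) * x ^ k) = ipoly S x" if "degree S \<le> n + 1" for S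
    using that by (subst poly_altdef) (auto intro!: sum.mono_neutral_right intro: le_degree simp del: sum.atMost_Suc)
  have num: "(\<Sum>i\<in>?I. of_int (F i) * (A ^ eA i * B ^ eB i * x ^ ex i)) = ipoly Q x - B * ipoly R x"
    unfolding split ip[OF deg(2), symmetric] ip[OF deg(3), symmetric]
    by (simp add: F_def eA_def eB_def ex_def sum_distrib_left sum_negf mult_ac del: sum.atMost_Suc)
  have den: "(\<Sum>i\<in>?I. of_int (G i) * (A ^ eA i * B ^ eB i * x ^ ex i)) = A * ipoly Q x - B * ipoly P x"
    unfolding split ip[OF deg(2), symmetric] ip[OF deg(1), symmetric]
    by (simp add: G_def eA_def eB_def ex_def sum_distrib_left sum_negf mult_ac del: sum.atMost_Suc)
  \<comment> \<open>Each of numerator and denominator involves two polynomials with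
    \<open>n + 2\<close> coefficients up to \<open>16 * 128 ^ n\<close>; the factor
    \<open>n + 2 \<le> 2 * 2 ^ n\<close> turns the base 128 into 256.\<close>
  have bound: "(\<Sum>k\<le>n + 1. real_of_int \<bar>coeff S k\<bar>) + (\<Sum>k\<le>n + 1. real_of_int \<bar>coeff T k\<bar>) \<le> 256 ^ (n + 1)"
    if "\<And>k. k \<le> n + 1 \<Longrightarrow> \<bar>coeff S k\<bar> \<le> 16 * 128 ^ n" "\<And>k. k \<le> n + 1 \<Longrightarrow> \<bar>coeff T k\<bar> \<le> 16 * 128 ^ n" for S T
  proof -
    have one: "(\<Sum>k\<le>n + 1. real_of_int \<bar>coeff S k\<bar>) \<le> real (n + 2) * (16 * 128 ^ n)"
      if S: "\<And>k. k \<le> n + 1 \<Longrightarrow> \<bar>coeff S k\<bar> \<le> 16 * 128 ^ n" for S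
    proof -
      have "real_of_int \<bar>coeff S k\<bar> \<le> real_of_int (16 * 128 ^ n)" if "k \<le> n + 1" for k
        using S[OF that] by (simp only: of_int_le_iff)
      then have "real_of_int \<bar>coeff S k\<bar> \<le> 16 * 128 ^ n" if "k \<le> n + 1" for k
        using that by simp
      then have "(\<Sum>k\<le>n + 1. real_of_int \<bar>coeff S k\<bar>) \<le> (\<Sum>k\<le>n + 1. 16 * 128 ^ n)"
        by (intro sum_mono) auto
      also have "\<dots> = real (n + 2) * (16 * 128 ^ n)" by (simp add: algebra_simps del: sum.atMost_Suc)
      finally show ?thesis .
    qed
    have "(\<Sum>k\<le>n + 1. real_of_int \<bar>coeff S k\<bar>) + (\<Sum>k\<le>n + 1. real_of_int \<bar>coeff T k\<bar>)
        \<le> real (n + 2) * (16 * 128 ^ n) + real (n + 2) * (16 * 128 ^ n)"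
      using one[of S, OF that(1)] one[of T, OF that(2)] by (rule add_mono)
    also have "\<dots> = real (n + 2) * (32 * 128 ^ n)" by simp
    also have "\<dots> \<le> (2 * 2 ^ n) * (32 * 128 ^ n)"
    proof (rule mult_right_mono)
      have "n + 2 \<le> 2 * Suc n" by simp
      also have "\<dots> \<le> 2 * 2 ^ n" using Suc_le_power_two[of n] by simp
      finally have "real (n + 2) \<le> real (2 * 2 ^ n)" by (rule of_nat_mono)
      then show "real (n + 2) \<le> 2 * 2 ^ n" by simp
    qed auto
    also have "\<dots> = 64 * (2 * 128) ^ n" by (simp only: power_mult_distrib)
    also have "\<dots> \<le> 256 ^ (n + 1)" by simp
    finally show ?thesis .
  qed
  have C: "(\<Sum>i\<in>?I. real_of_int \<bar>F i\<bar>) \<le> 256 ^ (n + 1)" "(\<Sum>i\<in>?I. real_of_int \<bar>G i\<bar>) \<le> 256 ^ (n + 1)"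
    unfolding split using bound[of Q R, OF Q R] bound[of P Q, OF P Q]
    by (simp_all add: F_def G_def del: sum.atMost_Suc)
  have "x ^ (2 * n + 1) * (A * ipoly Q x - B * ipoly P x) = ipoly Q x - B * ipoly R x"
  proof -
    have "x ^ (2 * n + 1) * (A * ipoly Q x - B * ipoly P x)
        = (A * x ^ (2 * n + 1)) * ipoly Q x - B * (x ^ (2 * n + 1) * ipoly P x)"
      by (simp add: algebra_simps)
    also have "A * x ^ (2 * n + 1) = 1 - B * (1 - x) ^ (2 * n + 1)"
      using AB by (simp add: algebra_simps)
    also have "x ^ (2 * n + 1) * ipoly P x = ipoly R x - (1 - x) ^ (2 * n + 1) * ipoly Q x"
      using id by (simp add: algebra_simps)
    finally show ?thesis by (simp add: algebra_simps)
  qed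
  then have xq: "x ^ (2 * n + 1) = (ipoly Q x - B * ipoly R x) / (A * ipoly Q x - B * ipoly P x)"
    using nz by (simp add: field_simps)
  have "weil_height (x ^ (2 * n + 1)) \<le> real 1 * weil_height A + real 1 * weil_height B
      + real (n + 1) * weil_height x + ln (256 ^ (n + 1))"
    unfolding xq num[symmetric] den[symmetric]
  proof (rule weil_height_quotient_le[OF alg(2,3,1) _ _ C])
    show "(\<Sum>i\<in>?I. of_int (G i) * (A ^ eA i * B ^ eB i * x ^ ex i)) \<noteq> 0"
      unfolding den by (rule nz)
  qed (auto simp: eA_def eB_def ex_def)
  moreover have "real (2 * n + 1) * weil_height x \<le> weil_height (x ^ (2 * n + 1))"
    using alg(1) by (intro weil_height_power_ge) auto
  moreover have "ln (256 ^ (n + 1)) = real (n + 1) * ln (256 :: real)" by (rule ln_realpow)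
  ultimately show ?thesis by (simp add: algebra_simps)
qed

section \<open>The unit equation\<close>

text \<open>In this quotient the powers of \<open>l\<close> cancel up to \<open>l ^ r\<close>, so
  its height does not grow with the height of \<open>l ^ m\<close>. It bounds the coefficients when
  a large solution is compared with a power of a smaller one.\<close>

lemma weil_height_power_quotient_le:
  fixes a l u u' :: complex
  assumes alg: "algebraic a" "algebraic l" "algebraic u" "algebraic u'"
    and nz: "a \<noteq> 0" "l \<noteq> 0" "u \<noteq> 0" "u' \<noteq> 0" and m: "m = (2 * k + 1) * n + r"
  shows "weil_height ((a * l ^ m / u') / (a * l ^ n / u) ^ (2 * k + 1))
    \<le> real (2 * k) * weil_height a + real r * weil_height l + weil_height u' + real (2 * k + 1) * weil_height u"
proof -
  have "l ^ ((2 * k + 1) * n) = (l ^ n) ^ (2 * k + 1)"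
    by (simp only: mult.commute[of _ n] power_mult)
  then have "l ^ m = (l ^ n) ^ (2 * k + 1) * l ^ r"
    by (simp only: m power_add[of l "(2 * k + 1) * n" r])
  then have "(a * l ^ m / u') / (a * l ^ n / u) ^ (2 * k + 1) = inverse a ^ (2 * k) * l ^ r * (inverse u' * u ^ (2 * k + 1))"
    using nz by (simp add: power_divide power_mult_distrib field_simps)
  also have "weil_height \<dots> \<le> weil_height (inverse a ^ (2 * k)) + weil_height (l ^ r)
      + (weil_height (inverse u') + weil_height (u ^ (2 * k + 1)))"
    using alg by (intro order.trans[OF weil_height_mult_le] add_mono weil_height_mult_le)
       (auto intro!: algebraic_mult algebraic_power algebraic_inverse)
  also have "\<dots> \<le> real (2 * k) * weil_height (inverse a) + real r * weil_height l
      + (weil_height (inverse u') + real (2 * k + 1) * weil_height u)"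
    using alg by (intro add_mono weil_height_power_le) auto
  finally show ?thesis using alg nz by (simp add: weil_height_inverse)
qed

text \<open>Let \<open>X\<close> and \<open>Y = 1 - X\<close> be the two summands. Up to factors of
  controlled height, \<open>l ^ n\<close>, \<open>m ^ n\<close> and \<open>(l / m) ^ n\<close> are
  \<open>X\<close>, \<open>Y\<close> and \<open>X / Y\<close>, each of height at most
  \<open>h(X) + ln 2\<close>.\<close>

lemma unit_equation_solution_height_ge:
  fixes a b l m u t :: complex
  assumes alg: "algebraic a" "algebraic b" "algebraic l" "algebraic m" "algebraic u" "algebraic t"
    and nz: "a \<noteq> 0" "b \<noteq> 0" "l \<noteq> 0" "m \<noteq> 0" "u \<noteq> 0" "t \<noteq> 0" and n: "n > 0"
    and h: "weil_height u \<le> s" "weil_height t \<le> s" "weil_height (u / t) \<le> s"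
    and H: "H = Max {weil_height (l / m), weil_height l, weil_height m}"
    and eq: "a * l ^ n / u + b * m ^ n / t = 1"
  shows "real n * H \<le> weil_height (a * l ^ n / u) + ln 2 + s + weil_height a + weil_height b"
proof -
  define X where "X = a * l ^ n / u"
  define Y where "Y = b * m ^ n / t"
  have Y: "Y = 1 - X" using eq by (simp add: X_def Y_def algebra_simps)
  have XY0: "X \<noteq> 0" "Y \<noteq> 0" using nz by (auto simp: X_def Y_def)
  then have "X \<noteq> 1" using Y by auto
  have algX: "algebraic X" unfolding X_def using alg by (intro algebraic_divide algebraic_mult algebraic_power)
  have algY: "algebraic Y" unfolding Y_def using alg by (intro algebraic_divide algebraic_mult algebraic_power)
  have hY: "weil_height Y \<le> weil_height X + ln 2" unfolding Y by (rule weil_height_one_minus_le[OF algX])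
  have hXY: "weil_height (X / Y) \<le> weil_height X + ln 2"
    unfolding Y by (rule weil_height_odds_le[OF algX \<open>X \<noteq> 1\<close>])
  have nonneg: "weil_height a \<ge> 0" "weil_height b \<ge> 0" using alg weil_height_nonneg by auto
  have ln2: "ln 2 \<ge> (0 :: real)" by simp
  have triple: "weil_height (x * y / z) \<le> weil_height x + weil_height y + weil_height z"
    if "algebraic x" "algebraic y" "algebraic z" "z \<noteq> 0" for x y z
    using weil_height_divide_le_add[of "x * y" z] weil_height_mult_le[of x y] that
    by (auto simp: algebraic_mult)
  have "l ^ n = X * u / a" using nz by (simp add: X_def)
  then have "weil_height (l ^ n) \<le> weil_height X + weil_height u + weil_height a"
    using triple[of X u a] alg algX nz by simp
  then have 1: "real n * weil_height l \<le> weil_height X + ln 2 + s + weil_height a + weil_height b"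
    using weil_height_power_ge[OF alg(3) n] h nonneg ln2 by linarith
  have "m ^ n = Y * t / b" using nz by (simp add: Y_def)
  then have "weil_height (m ^ n) \<le> weil_height Y + weil_height t + weil_height b"
    using triple[of Y t b] alg algY nz by simp
  then have 2: "real n * weil_height m \<le> weil_height X + ln 2 + s + weil_height a + weil_height b"
    using weil_height_power_ge[OF alg(4) n] h nonneg hY by linarith
  have "(l / m) ^ n = (X / Y) * (u / t) / (a / b)"
    using nz by (simp add: X_def Y_def field_simps)
  then have "weil_height ((l / m) ^ n) \<le> weil_height (X / Y) + weil_height (u / t) + weil_height (a / b)"
    using triple[of "X / Y" "u / t" "a / b"] alg algX algY nz by (simp add: algebraic_divide)
  moreover have "weil_height (a / b) \<le> weil_height a + weil_height b"
    using alg nz by (intro weil_height_divide_le_add)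
  ultimately have 3: "real n * weil_height (l / m) \<le> weil_height X + ln 2 + s + weil_height a + weil_height b"
    using weil_height_power_ge[OF algebraic_divide[OF alg(3,4)] n] h hXY by linarith
  have "H \<in> {weil_height (l / m), weil_height l, weil_height m}" unfolding H by (rule Max_in) auto
  with 1 2 3 show ?thesis unfolding X_def by auto
qed

text \<open>The gap argument: one solution \<open>n\<close> with large height is fixed and compared with the
  solutions \<open>m\<close>, where \<open>m / n\<close> tends to infinity.\<close>

lemma finite_unit_equation_solutions:
  fixes a b l m :: complex and d :: real
  assumes alg: "algebraic a" "algebraic b" "algebraic l" "algebraic m"
    and nz: "a \<noteq> 0" "b \<noteq> 0" "l \<noteq> 0" "m \<noteq> 0"
    and H: "H = Max {weil_height (l / m), weil_height l, weil_height m}" "H > 0"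
    and d: "0 < d" "d < 1 / 9"
    and sol: "\<And>n. n \<in> S \<Longrightarrow> \<exists>u t. algebraic u \<and> algebraic t \<and> u \<noteq> 0 \<and> t \<noteq> 0 \<and>
      weil_height u \<le> real n * d * H \<and> weil_height t \<le> real n * d * H \<and> weil_height (u / t) \<le> real n * d * H \<and>
      a * l ^ n / u + b * m ^ n / t = 1"
  shows "finite S"
proof (rule ccontr)
  assume "infinite S"
  then have unbounded: "\<exists>n\<in>S. k < n" for k by (meson infinite_nat_iff_unbounded)
  define c where "c = weil_height a + weil_height b"
  define K :: real where "K = ln 256"
  have "K > 0" by (simp add: K_def)
  have nonneg: "weil_height a \<ge> 0" "weil_height b \<ge> 0" "weil_height l \<ge> 0" "weil_height m \<ge> 0"
    using alg weil_height_nonneg by auto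
  have Hle: "weil_height l \<le> H" "weil_height m \<le> H" unfolding H by (auto intro: Max_ge)
  \<comment> \<open>The threshold makes \<open>n (1 - 9 d) H - ln 2 - 3 c - K\<close> at least 1. Of
    \<open>9 d\<close>, one \<open>d\<close> is lost in the lower bound for \<open>h(X)\<close>, and
    four each in the heights of \<open>A\<close> and \<open>B\<close>.\<close>
  obtain n where n: "n \<in> S" "nat \<lceil>(ln 2 + 5 * c + K + 1) / ((1 - 9 * d) * H)\<rceil> < n"
    using unbounded by blast
  have dH: "(1 - 9 * d) * H > 0" using d H by simp
  have "(ln 2 + 5 * c + K + 1) / ((1 - 9 * d) * H) < real n" using n(2) by linarith
  then have big: "ln 2 + 5 * c + K + 1 < real n * ((1 - 9 * d) * H)"
    using dH by (simp add: pos_divide_less_eq)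
  have "n > 0" using n(2) by simp
  obtain u t where ut: "algebraic u" "algebraic t" "u \<noteq> 0" "t \<noteq> 0"
      "weil_height u \<le> real n * d * H" "weil_height t \<le> real n * d * H" "weil_height (u / t) \<le> real n * d * H"
      "a * l ^ n / u + b * m ^ n / t = 1"
    using sol[OF n(1)] by blast
  define X where "X = a * l ^ n / u"
  define Y where "Y = b * m ^ n / t"
  have Y: "Y = 1 - X" using ut(8) by (simp add: X_def Y_def algebra_simps)
  have XY0: "X \<noteq> 0" "Y \<noteq> 0" using nz ut by (auto simp: X_def Y_def)
  then have "X \<noteq> 1" using Y by auto
  have algX: "algebraic X" unfolding X_def using alg ut by (intro algebraic_divide algebraic_mult algebraic_power)
  have algY: "algebraic Y" unfolding Y_def using alg ut by (intro algebraic_divide algebraic_mult algebraic_power)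
  have lower: "real n * H \<le> weil_height X + ln 2 + real n * d * H + c"
    using unit_equation_solution_height_ge[OF alg(1,2,3,4) ut(1,2) nz ut(3,4) \<open>n > 0\<close> ut(5,6,7) H(1) ut(8)]
    by (simp add: X_def c_def)
  \<comment> \<open>\<open>E\<close> collects the terms of the final inequality without the factor
    \<open>k\<close>. It depends on \<open>n\<close> only, so a later solution \<open>p\<close> can
    be chosen with \<open>k > E\<close>.\<close>
  define E where "E = 4 * real n * H + 8 * (real n * d * H) + K"
  obtain p where p: "p \<in> S" "(2 * nat \<lceil>E\<rceil> + 3) * n < p" using unbounded by blast
  have "p \<ge> n" using p(2) by (simp add: add_mult_distrib)
  \<comment> \<open>Here \<open>2 k + 1\<close> is the largest odd number up to
    \<open>p div n\<close>, so the remainder \<open>r\<close> stays below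
    \<open>2 n\<close>.\<close>
  define k where "k = (p div n - 1) div 2"
  define r where "r = p - (2 * k + 1) * n"
  have pd: "p div n \<ge> 1" using \<open>p \<ge> n\<close> \<open>n > 0\<close> by (simp add: Suc_le_eq div_greater_zero_iff)
  have k: "2 * k + 1 \<le> p div n" "p div n \<le> 2 * k + 2" using pd unfolding k_def by linarith+
  have "(2 * k + 1) * n \<le> p div n * n" using k(1) by (rule mult_right_mono) simp
  also have "\<dots> \<le> p" by simp
  finally have pr: "p = (2 * k + 1) * n + r" by (simp add: r_def)
  have "p < (p div n + 1) * n" using \<open>n > 0\<close> by (metis Suc_eq_plus1 dividend_less_div_times mult.commute mult_Suc)
  also have "\<dots> \<le> (2 * k + 3) * n" using k(2) by (intro mult_right_mono) auto
  finally have p_less: "p < (2 * k + 3) * n" .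
  then have r: "r \<le> 2 * n" using pr by (simp add: algebra_simps)
  have kE: "real k > E"
  proof -
    have "(2 * nat \<lceil>E\<rceil> + 3) * n < (2 * k + 3) * n" using p(2) p_less by linarith
    then have "nat \<lceil>E\<rceil> < k" by simp
    then show ?thesis by linarith
  qed
  obtain u' t' where ut': "algebraic u'" "algebraic t'" "u' \<noteq> 0" "t' \<noteq> 0"
      "weil_height u' \<le> real p * d * H" "weil_height t' \<le> real p * d * H"
      "a * l ^ p / u' + b * m ^ p / t' = 1"
    using sol[OF p(1)] by blast
  define A where "A = (a * l ^ p / u') / X ^ (2 * k + 1)"
  define B where "B = (b * m ^ p / t') / Y ^ (2 * k + 1)"
  have algA: "algebraic A"
    unfolding A_def using alg ut' algX by (intro algebraic_divide algebraic_mult algebraic_power)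
  have algB: "algebraic B"
    unfolding B_def using alg ut' algY by (intro algebraic_divide algebraic_mult algebraic_power)
  have "A * X ^ (2 * k + 1) + B * (1 - X) ^ (2 * k + 1) = 1"
    using ut'(7) XY0 unfolding A_def B_def Y[symmetric] by simp
  from weil_height_unit_power_bound[OF algX algA algB \<open>X \<noteq> 1\<close> this]
  have upper: "real k * weil_height X \<le> weil_height A + weil_height B + real (k + 1) * K"
    by (simp only: K_def)
  have pd_le: "real p * d * H \<le> (2 * real k + 3) * (real n * d * H)"
  proof -
    have "real p \<le> real ((2 * k + 3) * n)" using p_less by (intro of_nat_mono) simp
    then have "real p * (d * H) \<le> real ((2 * k + 3) * n) * (d * H)"
      using d H by (intro mult_right_mono) auto
    then show ?thesis by (simp add: algebra_simps)
  qed
  have part: "weil_height ((a * l ^ p / u') / (a * l ^ n / u) ^ (2 * k + 1))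
      \<le> 2 * real k * weil_height a + 2 * real n * H + (4 * real k + 4) * (real n * d * H)"
    if "algebraic a" "algebraic l" "algebraic u" "algebraic u'" "a \<noteq> 0" "l \<noteq> 0" "u \<noteq> 0" "u' \<noteq> 0"
      "weil_height l \<le> H" "weil_height u \<le> real n * d * H" "weil_height u' \<le> real p * d * H" for a l u u'
  proof -
    have "real r * weil_height l \<le> real (2 * n) * H"
      using r that H by (intro mult_mono of_nat_mono) (auto intro: weil_height_nonneg)
    moreover have "real (2 * k + 1) * weil_height u \<le> real (2 * k + 1) * (real n * d * H)"
      using that by (intro mult_left_mono) auto
    ultimately show ?thesis
      using weil_height_power_quotient_le[OF that(1-8) pr] that(11) pd_le by (simp add: algebra_simps)
  qed
  have "weil_height A \<le> 2 * real k * weil_height a + 2 * real n * H + (4 * real k + 4) * (real n * d * H)"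
    unfolding A_def X_def using alg nz ut ut' Hle by (intro part)
  moreover have "weil_height B \<le> 2 * real k * weil_height b + 2 * real n * H + (4 * real k + 4) * (real n * d * H)"
    unfolding B_def Y_def using alg nz ut ut' Hle by (intro part)
  ultimately have "real k * weil_height X \<le> 2 * real k * c + 4 * real n * H + (8 * real k + 8) * (real n * d * H) + real (k + 1) * K"
    using upper by (simp add: c_def algebra_simps)
  moreover have "real k * (real n * H - ln 2 - real n * d * H - c) \<le> real k * weil_height X"
    using lower by (intro mult_left_mono) auto
  ultimately have "real k * (real n * ((1 - 9 * d) * H) - ln 2 - 3 * c - K) \<le> E"
    by (simp add: E_def algebra_simps)
  moreover have "real k * 1 \<le> real k * (real n * ((1 - 9 * d) * H) - ln 2 - 3 * c - K)"
    using big nonneg by (intro mult_left_mono) (auto simp: c_def)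
  ultimately show False using kE by linarith
qed

section \<open>Reduction of the distance problem to the unit equation\<close>

lemma mat_power_mult_vec:
  assumes "D \<in> Diag3"
  shows "mat_power D n *v x = (\<chi> i. (D $ i $ i) ^ n * x $ i)"
proof (induction n)
  case 0
  show ?case by (simp add: mat_power_def vec_eq_iff)
next
  case (Suc n)
  have diag: "D *v y = (\<chi> i. D $ i $ i * y $ i)" for y
  proof -
    have "(\<Sum>j\<in>UNIV. D $ i $ j * y $ j) = (\<Sum>j\<in>{i}. D $ i $ j * y $ j)" for i
      using assms by (intro sum.mono_neutral_right) (auto simp: Diag3_def)
    then show ?thesis by (simp add: matrix_vector_mult_def)
  qed
  have "mat_power D (Suc n) *v x = D *v (mat_power D n *v x)"
    by (simp add: mat_power_def matrix_vector_mul_assoc)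
  then show ?case by (simp add: Suc diag mult_ac)
qed

text \<open>Nonemptiness is what allows a point to be extracted from an upper bound on the infimum
  in \<open>dstar_set\<close>.\<close>

lemma perp_nonempty:
  assumes "v \<in> Gm3"
  shows "perp v \<noteq> {}"
proof -
  define y :: "complex ^ 3" where "y = (\<chi> i. (if i = 3 then -2 else 1) / v $ i)"
  have "y \<in> perp v"
    using assms by (auto simp: perp_def Gm3_def y_def algebraic_divide)
  then show ?thesis by blast
qed

lemma hstar_ge:
  "weil_height (z $ 1 / z $ 2) \<le> hstar z" "weil_height (z $ 1 / z $ 3) \<le> hstar z"
  "weil_height (z $ 2 / z $ 3) \<le> hstar z"
  unfolding hstar_def by (auto intro: Max_ge)

theorem theorem3p1:
  fixes v :: "complex ^ 3" and D :: "complex ^ 3 ^ 3"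
  assumes "v \<in> Gm3" and "D \<in> Diag3" and "hstar_mat D > 0"
  shows "\<forall>\<delta>::real. 0 < \<delta> \<and> \<delta> < 1 / 9 \<longrightarrow> (\<forall>x\<in>Gm3.
           finite {n::nat. dstar_set (mat_power D n *v x) (perp v) \<le> real n * \<delta> * hstar_mat D})"
proof (intro allI impI ballI)
  fix d :: real and x :: "complex ^ 3"
  assume d: "0 < d \<and> d < 1 / 9" and x: "x \<in> Gm3"
  \<comment> \<open>The infimum need not be attained; the room between \<open>d\<close> and
    \<open>d'\<close> provides a point \<open>y\<close> of \<open>perp v\<close> at distance below
    \<open>n d' H\<close>.\<close>
  define d' where "d' = (d + 1 / 9) / 2"
  have d': "d < d'" "0 < d'" "d' < 1 / 9" using d by (auto simp: d'_def)
  define H where "H = hstar_mat D"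
  define l where "l i = D $ i $ i" for i
  let ?S = "{n. dstar_set (mat_power D n *v x) (perp v) \<le> real n * d * H}"
  have l: "algebraic (l i)" "l i \<noteq> 0" for i using assms(2) by (auto simp: l_def Diag3_def)
  have v: "algebraic (v $ i)" "v $ i \<noteq> 0" for i using assms(1) by (auto simp: Gm3_def)
  have x: "algebraic (x $ i)" "x $ i \<noteq> 0" for i using x by (auto simp: Gm3_def)
  \<comment> \<open>The equation \<open>v_1 y_1 + v_2 y_2 + v_3 y_3 = 0\<close> is divided by
    \<open>- v_3 y_3\<close>; the third term becomes \<open>-1\<close> and the \<open>a i\<close>
    are the constant factors of the other two.\<close>
  define a where "a i = - (v $ i * x $ i) / (v $ 3 * x $ 3)" for i
  have a: "algebraic (a i)" "a i \<noteq> 0" for i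
    using v x by (auto simp: a_def intro!: algebraic_divide algebraic_mult algebraic_minus)
  \<comment> \<open>For \<open>n = 0\<close> the bounds with \<open>d\<close> and \<open>d'\<close>
    coincide, so this single value is set aside.\<close>
  have "finite (?S - {0})"
  proof (rule finite_unit_equation_solutions[of "a 1" "a 2" "l 1 / l 3" "l 2 / l 3"])
    have ratio: "l 1 / l 3 / (l 2 / l 3) = l 1 / l 2" using l by simp
    show "H = Max {weil_height (l 1 / l 3 / (l 2 / l 3)), weil_height (l 1 / l 3), weil_height (l 2 / l 3)}"
      unfolding ratio H_def hstar_mat_def hstar_def by (simp only: l_def vec_lambda_beta)
  next
    fix n assume "n \<in> ?S - {0}"
    then have "n > 0" by auto
    have "dstar_set (mat_power D n *v x) (perp v) \<le> real n * d * H"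
      using \<open>n \<in> ?S - {0}\<close> by auto
    also have "real n * d * H < real n * d' * H"
      using \<open>n > 0\<close> d' assms(3) by (simp add: H_def)
    finally have "(INF y\<in>perp v. dstar (mat_power D n *v x) y) < real n * d' * H"
      by (simp add: dstar_set_def)
    from cInf_lessD[OF _ this] perp_nonempty[OF assms(1)] obtain y where
      y: "y \<in> perp v" "dstar (mat_power D n *v x) y < real n * d' * H"
      by auto
    have ya: "algebraic (y $ i)" "y $ i \<noteq> 0" for i using y by (auto simp: perp_def Gm3_def)
    \<comment> \<open>With \<open>u = z_1 / z_3\<close> and \<open>t = z_2 / z_3\<close>, the
      numbers \<open>u\<close>, \<open>t\<close> and \<open>u / t\<close> are exactly the three
      ratios in \<open>hstar z\<close>.\<close>
    define z where "z = (mat_power D n *v x) * (\<chi> i. inverse (y $ i))"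
    have z: "z $ i = l i ^ n * x $ i / y $ i" for i
      by (simp add: z_def mat_power_mult_vec[OF assms(2)] l_def divide_inverse)
    have za: "algebraic (z $ i)" "z $ i \<noteq> 0" for i
      unfolding z using l x ya by (auto intro!: algebraic_divide algebraic_mult algebraic_power)
    have hz: "hstar z < real n * d' * H" using y(2) by (simp add: dstar_def z_def)
    have X: "a i * (l i / l 3) ^ n / (z $ i / z $ 3) = - (v $ i * y $ i) / (v $ 3 * y $ 3)" for i
      using l v x ya by (simp add: a_def z field_simps)
    have "a 1 * (l 1 / l 3) ^ n / (z $ 1 / z $ 3) + a 2 * (l 2 / l 3) ^ n / (z $ 2 / z $ 3) = 1"
    proof -
      have sum: "- (v $ 1 * y $ 1) + - (v $ 2 * y $ 2) = v $ 3 * y $ 3"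
        using y(1) by (auto simp: perp_def algebra_simps add_eq_0_iff)
      show ?thesis
        unfolding X add_divide_distrib[symmetric] sum using v ya by simp
    qed
    moreover have "z $ 1 / z $ 3 / (z $ 2 / z $ 3) = z $ 1 / z $ 2" using za by simp
    ultimately show "\<exists>u t. algebraic u \<and> algebraic t \<and> u \<noteq> 0 \<and> t \<noteq> 0 \<and>
      weil_height u \<le> real n * d' * H \<and> weil_height t \<le> real n * d' * H \<and> weil_height (u / t) \<le> real n * d' * H \<and>
      a 1 * (l 1 / l 3) ^ n / u + a 2 * (l 2 / l 3) ^ n / t = 1"
      using za hz hstar_ge[of z]
      by (intro exI[of _ "z $ 1 / z $ 3"] exI[of _ "z $ 2 / z $ 3"]) (auto simp: algebraic_divide)
  qed (use l a d' assms(3) in \<open>auto simp: H_def algebraic_divide\<close>)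
  then show "finite {n. dstar_set (mat_power D n *v x) (perp v) \<le> real n * d * hstar_mat D}"
    by (simp add: H_def)
qed

end
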